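(* Let $V\ge 0$ be locally integrable on $\mathbb{R}^2$. If $N_-(\mathcal{E}_{\alpha V}) = O(\alpha)$ as $\alpha\to+\infty$, then $\|(A_n)_{n\in\mathbb{Z}}\|_{1,\infty}<\infty$.
   Context: For a Hermitian form $\mathbf{q}$ with domain $\mathrm{Dom}(\mathbf{q})$ in a Hilbert space, $N_-(\mathbf{q}) := \sup\{\dim\mathcal{L} : \mathcal{L}\subseteq \mathrm{Dom}(\mathbf{q}) \text{ a linear subspace},\ \mathbf{q}[u]<0\ \forall u\in\mathcal{L}\setminus\{0\}\}\in\{0,1,2,\dots\}\cup\{\infty\}$. For locally integrable $V\ge 0$ on $\mathbb{R}^2$, $\mathcal{E}_V[w] := \int_{\mathbb{R}^2}|\nabla w(x)|^2dx - \int_{\mathbb{R}^2}V(x)|w(x)|^2dx$ with $\mathrm{Dom}(\mathcal{E}_V) := W^1_2(\mathbb{R}^2)\cap L_2(\mathbb{R}^2,V(x)dx)$, where $W^1_2$ is the Sobolev space of $L_2$ functions with $L_2$ first-order weak derivatives. Annuli: $U_n := \{x\in\mathbb{R}^2 : e^{2^{n-1}}<|x|<e^{2^n}\}$ for $n>0$; $U_0 := \{e^{-1}<|x|<e\}$; $U_n := \{e^{-2^{|n|}}<|x|<e^{-2^{|n|-1}}\}$ for $n<0$. Set $A_0 := \int_{U_0}V(x)\,dx$ and $A_n := \int_{U_n}V(x)|\ln|x||\,dx$ for $n\ne 0$. $\|(a_n)_{n\in\mathbb{Z}}\|_{1,\infty} := \sup_{s>0}\big(s\,\mathrm{card}\{n\in\mathbb{Z}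 : |a_n|>s\}\big)$. *)

theory Defs
  imports "HOL-Analysis.Analysis" "HOL-Library.Function_Algebras"
begin

interpretation cfun: vector_space "\<lambda>(c::complex) (u :: 'a \<Rightarrow> complex) x. c * u x"
  by unfold_locales (auto simp: fun_eq_iff algebra_simps)

text \<open>
  Elements of \<open>L\<^sub>2\<close> are represented by functions, identified when they agree almost everywhere.
  Accordingly a linear subspace of \<open>L\<^sub>2\<close> is given by a linear subspace of functions, and its
  dimension is the number of linearly independent elements modulo null functions.  The library's
  \<open>dim\<close> is not usable here, since it returns \<open>0\<close> on infinite-dimensional spaces.
\<close>

definition ae_independent :: "('a::euclidean_space \<Rightarrow> complex) set \<Rightarrow> bool" where
  "ae_independent B \<longleftrightarrow>
     (\<forall>c. (AE x in lebesgue. (\<Sum>u\<in>B. c u * u x) = 0) \<longrightarrow> (\<forall>u\<in>B. c u = 0))"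

definition ae_dim :: "('a::euclidean_space \<Rightarrow> complex) set \<Rightarrow> enat" where
  "ae_dim L = (SUP B \<in> {B. finite B \<and> B \<subseteq> L \<and> ae_independent B}. enat (card B))"

text \<open>A Hermitian form is given by its domain \<open>D\<close> and its quadratic form \<open>q\<close>.\<close>

definition N_minus ::
    "('a::euclidean_space \<Rightarrow> complex) set \<Rightarrow> (('a \<Rightarrow> complex) \<Rightarrow> real) \<Rightarrow> enat" where
  "N_minus D q =
     (SUP L \<in> {L. cfun.subspace L \<and> L \<subseteq> D \<and>
                  (\<forall>u\<in>L. \<not> (AE x in lebesgue. u x = 0) \<longrightarrow> q u < 0)}. ae_dim L)"

definition locally_integrable ::
    "('a::euclidean_space \<Rightarrow> 'b::{banach, second_countable_topology}) \<Rightarrow> bool" where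
  "locally_integrable f \<longleftrightarrow> (\<forall>K. compact K \<longrightarrow> set_integrable lebesgue K f)"

primrec C_k :: "nat \<Rightarrow> ('a::euclidean_space \<Rightarrow> real) \<Rightarrow> bool" where
  "C_k 0 f \<longleftrightarrow> continuous_on UNIV f"
| "C_k (Suc k) f \<longleftrightarrow> (\<forall>x. f differentiable (at x)) \<and>
     (\<forall>b\<in>Basis. C_k k (\<lambda>x. frechet_derivative f (at x) b))"

definition test_function :: "('a::euclidean_space \<Rightarrow> real) \<Rightarrow> bool" where
  "test_function \<phi> \<longleftrightarrow> (\<forall>k. C_k k \<phi>) \<and> compact (closure {x. \<phi> x \<noteq> 0})"

definition is_weak_pderiv ::
    "'a::euclidean_space \<Rightarrow> ('a \<Rightarrow> complex) \<Rightarrow> ('a \<Rightarrow> complex) \<Rightarrow> bool" where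
  "is_weak_pderiv b w g \<longleftrightarrow> locally_integrable w \<and> locally_integrable g \<and>
     (\<forall>\<phi>. test_function \<phi> \<longrightarrow>
        (LINT x|lebesgue. frechet_derivative \<phi> (at x) b *\<^sub>R w x) =
        - (LINT x|lebesgue. \<phi> x *\<^sub>R g x))"

text \<open>Weak derivatives are unique up to null sets, so the choice does not affect integrals.\<close>

definition weak_pderiv :: "'a::euclidean_space \<Rightarrow> ('a \<Rightarrow> complex) \<Rightarrow> 'a \<Rightarrow> complex" where
  "weak_pderiv b w = (SOME g. is_weak_pderiv b w g)"

definition weak_grad_norm_sq :: "('a::euclidean_space \<Rightarrow> complex) \<Rightarrow> 'a \<Rightarrow> real" where
  "weak_grad_norm_sq w x = (\<Sum>b\<in>Basis. (norm (weak_pderiv b w x))\<^sup>2)"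

text \<open>\<open>L2 V\<close> is the weighted space \<open>L\<^sub>2(V(x) dx)\<close>, for a weight \<open>V \<ge> 0\<close>.\<close>

definition L2 :: "('a::euclidean_space \<Rightarrow> real) \<Rightarrow> ('a \<Rightarrow> complex) set" where
  "L2 V = {u \<in> borel_measurable lebesgue. integrable lebesgue (\<lambda>x. V x * (norm (u x))\<^sup>2)}"

definition W12 :: "('a::euclidean_space \<Rightarrow> complex) set" where
  "W12 = {w \<in> L2 (\<lambda>_. 1). \<forall>b\<in>Basis. \<exists>g \<in> L2 (\<lambda>_. 1). is_weak_pderiv b w g}"

definition form_E :: "(real^2 \<Rightarrow> real) \<Rightarrow> (real^2 \<Rightarrow> complex) \<Rightarrow> real" where
  "form_E V w = (LINT x|lebesgue. weak_grad_norm_sq w x) -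
                (LINT x|lebesgue. V x * (norm (w x))\<^sup>2)"

definition dom_E :: "(real^2 \<Rightarrow> real) \<Rightarrow> (real^2 \<Rightarrow> complex) set" where
  "dom_E V = W12 \<inter> L2 V"

definition annulus :: "int \<Rightarrow> (real^2) set" where
  "annulus n =
     (if n > 0 then {x. exp (2 powi (n - 1)) < norm x \<and> norm x < exp (2 powi n)}
      else if n = 0 then {x. exp (- 1) < norm x \<and> norm x < exp 1}
      else {x. exp (- (2 powi \<bar>n\<bar>)) < norm x \<and> norm x < exp (- (2 powi (\<bar>n\<bar> - 1)))})"

definition A_seq :: "(real^2 \<Rightarrow> real) \<Rightarrow> int \<Rightarrow> real" where
  "A_seq V n =
     (if n = 0 then (LINT x:annulus 0|lebesgue. V x)
      else (LINT x:annulus n|lebesgue. V x * \<bar>ln (norm x)\<bar>))"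

text \<open>The counting measure is used for \<open>card\<close> because it is \<open>\<infinity>\<close> on infinite sets.\<close>

definition weak_l1_norm :: "(int \<Rightarrow> real) \<Rightarrow> ennreal" where
  "weak_l1_norm a =
     (SUP s \<in> {0<..}. ennreal s * emeasure (count_space UNIV) {n. \<bar>a n\<bar> > s})"

end

theory Submission
  imports Defs
begin

text \<open>
  In the coordinate \<open>t = ln (norm x)\<close>, a bump adapted to an interval of length \<open>l\<close> has Dirichlet
  energy of order \<open>1 / l\<close> times the square of its height.  The interval of length comparable to
  \<open>2 ^ \<bar>n\<bar>\<close> around \<open>annulus n\<close> therefore carries a bump on which the form is negative as soon as
  \<open>\<alpha> * A_seq V n\<close> exceeds an absolute constant.  Bumps whose indices agree modulo 3 have disjoint
  supports, so they span a negative subspace, and \<open>N_minus\<close> dominates a third of the number of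
  \<open>n\<close> with \<open>A_seq V n > const / \<alpha>\<close>.
\<close>

subsection \<open>Integration by parts\<close>

text \<open>Write l for the logarithmic length of an interval. The bump is the squared positive part
  of a quadratic in t, hence C1 across both ends, so that its classical derivatives serve as weak
  ones. Its energy is at most \<open>3 * pi * (exp 1)\<^sup>2 * l ^ 7\<close>, its square is at
  least \<open>l ^ 8 / 7 ^ 8\<close> on the annulus, and \<open>A_seq V n\<close> is at most l times
  the integral of \<open>V\<close> over the annulus. The powers of l cancel and leave the constant
  \<open>threshold\<close>. The main obstacle is the form itself: \<open>weak_pderiv\<close> is an
  arbitrary choice among weak derivatives, so the form of a concrete function can be evaluated only
  once weak derivatives are known to be unique almost everywhere. That takes enough smooth test
  functions to detect a nonzero function, hence the bumps built from \<open>exp (- 1 / s)\<close>.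
  The growth hypothesis speaks of large \<alpha> and so controls only small levels
  \<open>s = threshold / \<alpha>\<close>.\<close>

lemma integral_translation:
  fixes f :: "'a::euclidean_space \<Rightarrow> 'b::{banach, second_countable_topology}"
  assumes "f \<in> borel_measurable borel"
  shows "(LINT x|lborel. f (x + h)) = (LINT x|lborel. f x)"
proof -
  have "(LINT x|lborel. f x) = (LINT x|distr lborel borel ((+) h). f x)"
    by (simp add: lborel_distr_plus)
  also have "\<dots> = (LINT x|lborel. f (h + x))"
    by (rule integral_distr) (use assms in auto)
  finally show ?thesis by (simp add: add.commute)
qed

lemma continuous_compact_support_bounded:
  fixes f :: "'a::euclidean_space \<Rightarrow> 'b::real_normed_vector"
  assumes "continuous_on UNIV f" "compact K" "\<And>x. x \<notin> K \<Longrightarrow> f x = 0"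
  obtains B where "B > 0" "\<And>x. norm (f x) \<le> B"
proof -
  have "compact (f ` K)"
    by (rule compact_continuous_image[OF continuous_on_subset[OF assms(1)] assms(2)]) auto
  then obtain B where B: "B > 0" "\<forall>y\<in>f ` K. norm y \<le> B"
    using bounded_pos compact_imp_bounded by metis
  have "norm (f x) \<le> B" for x
    using B assms(3)[of x] by (cases "x \<in> K") auto
  then show ?thesis using that B(1) by blast
qed

lemma integrable_continuous_compact_support:
  fixes f :: "'a::euclidean_space \<Rightarrow> 'b::{banach, second_countable_topology}"
  assumes "continuous_on UNIV f" "compact K" "\<And>x. x \<notin> K \<Longrightarrow> f x = 0"
  shows "integrable lborel f" "integrable lebesgue f"
proof -
  have "integrable lborel (\<lambda>x. indicator K x *\<^sub>R f x)"
    by (rule borel_integrable_compact[OF assms(2) continuous_on_subset[OF assms(1)]]) auto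
  also have "(\<lambda>x. indicator K x *\<^sub>R f x) = f"
    using assms(3) by (auto simp: fun_eq_iff indicator_def)
  finally show "integrable lborel f" .
  then show "integrable lebesgue f"
    by (simp add: integrable_completion assms(1) borel_measurable_continuous_onI)
qed

text \<open>Translation invariance makes the integral of every difference quotient in direction
  \<open>b\<close> zero, and dominated convergence carries this over to the derivative. Applied to a
  product, this is integration by parts.\<close>

lemma integral_directional_derivative_zero:
  fixes f :: "'a::euclidean_space \<Rightarrow> 'b::{banach, second_countable_topology}"
  assumes der: "\<And>x. (f has_derivative f' x) (at x)"
    and cont: "continuous_on UNIV (\<lambda>x. f' x b)"
    and K: "compact K" "\<And>x. x \<notin> K \<Longrightarrow> f x = 0"
  shows "(LINT x|lebesgue. f' x b) = 0"
proof -
  have contf: "continuous_on UNIV f"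
    by (intro continuous_at_imp_continuous_on ballI has_derivative_continuous[OF der])
  have line: "((\<lambda>t. f (x + t *\<^sub>R b)) has_vector_derivative f' (x + t *\<^sub>R b) b) (at t)" for x t
  proof -
    have "((\<lambda>t. x + t *\<^sub>R b) has_derivative (\<lambda>h. h *\<^sub>R b)) (at t)"
      by (auto intro!: derivative_eq_intros)
    from has_derivative_compose[OF this der] show ?thesis
      by (simp add: has_vector_derivative_def linear_cmul[OF has_derivative_linear[OF der]])
  qed
  have zero: "f' x b = 0" if "x \<notin> K" for x
  proof -
    have "open (- K)" using K(1) compact_imp_closed by blast
    then have "((\<lambda>x. 0) has_derivative f' x) (at x)"
      using has_derivative_transform_within_open[OF der, of "-K" x "\<lambda>x. 0"] that K(2) by auto
    then have "f' x = (\<lambda>x. 0)"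
      using has_derivative_const has_derivative_unique by blast
    then show ?thesis by simp
  qed
  obtain B where B: "B > 0" "\<And>x. norm (f' x b) \<le> B"
    using continuous_compact_support_bounded[OF cont K(1) zero] by blast
  have lip: "norm (f (x + t *\<^sub>R b) - f x) \<le> B * \<bar>t\<bar>" for x t
  proof -
    have "norm (f (x + t *\<^sub>R b) - f (x + 0 *\<^sub>R b)) \<le> B * norm (t - 0)"
    proof (rule differentiable_bound[where S=UNIV and f'="\<lambda>t h. h *\<^sub>R f' (x + t *\<^sub>R b) b"])
      show "((\<lambda>t. f (x + t *\<^sub>R b)) has_derivative (\<lambda>h. h *\<^sub>R f' (x + t *\<^sub>R b) b)) (at t)" for t
        using line by (simp add: has_vector_derivative_def)
      show "onorm (\<lambda>h. h *\<^sub>R f' (x + t *\<^sub>R b) b) \<le> B" for t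
        by (rule onorm_le) (use mult_right_mono[OF B(2) abs_ge_zero] in \<open>simp add: mult.commute\<close>)
    qed auto
    then show ?thesis by simp
  qed
  define h where "h n = inverse (real (Suc n))" for n
  have h: "h \<longlonglongrightarrow> 0" "h n > 0" "h n \<le> 1" for n
    using LIMSEQ_inverse_real_of_nat by (auto simp: h_def[abs_def] divide_simps)
  \<comment> \<open>Fattening \<open>K\<close> by the length of \<open>b\<close> catches the
    supports of all quotients \<open>d n\<close>, because the steps \<open>h n\<close> are at most
    1. One multiple of the indicator of \<open>K'\<close> then dominates them all.\<close>
  define K' where "K' = (\<lambda>(x, y). x + y) ` (K \<times> cball 0 (norm b))"
  have K': "compact K'"
    unfolding K'_def using K(1)
    by (intro compact_continuous_image compact_Times) (auto simp: split_beta intro!: continuous_intros)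
  have inK': "x \<in> K'" if "x + t *\<^sub>R b \<in> K" "\<bar>t\<bar> \<le> 1" for x t
  proof -
    have "x = (x + t *\<^sub>R b) + (- t *\<^sub>R b)" by simp
    moreover have "(- t *\<^sub>R b) \<in> cball 0 (norm b)"
      using that(2) by (auto simp: mult_left_le_one_le)
    ultimately show ?thesis unfolding K'_def using that(1)
      by (intro image_eqI[of _ _ "(x + t *\<^sub>R b, - t *\<^sub>R b)"]) auto
  qed
  define d where "d n x = (1 / h n) *\<^sub>R (f (x + h n *\<^sub>R b) - f x)" for n x
  have dint: "(LINT x|lborel. d n x) = 0" for n
  proof -
    have "continuous_on UNIV (\<lambda>x. f (x + h n *\<^sub>R b))"
      by (intro continuous_on_compose2[OF contf] continuous_intros) auto
    then have i: "integrable lborel (\<lambda>x. f (x + h n *\<^sub>R b))"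
      by (rule integrable_continuous_compact_support[OF _ K'])
         (use inK'[of _ "h n"] h(2)[of n] h(3)[of n] K(2) in force)
    show ?thesis unfolding d_def
      using i integrable_continuous_compact_support(1)[OF contf K]
        integral_translation[OF borel_measurable_continuous_onI[OF contf]]
      by simp
  qed
  have "(\<lambda>n. LINT x|lborel. d n x) \<longlonglongrightarrow> (LINT x|lborel. f' x b)"
  proof (rule integral_dominated_convergence[where w="\<lambda>x. indicator K' x * B"])
    show "(\<lambda>x. f' x b) \<in> borel_measurable lborel"
      using borel_measurable_continuous_onI[OF cont] by simp
    show "d n \<in> borel_measurable lborel" for n
    proof -
      have "continuous_on UNIV (d n)" unfolding d_def
        by (intro continuous_intros continuous_on_compose2[OF contf]) auto
      then show ?thesis using borel_measurable_continuous_onI by simp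
    qed
    have "integrable lborel (\<lambda>x. indicator K' x *\<^sub>R B)"
      by (rule borel_integrable_compact[OF K']) auto
    then show "integrable lborel (\<lambda>x. indicator K' x * B)" by simp
    show "AE x in lborel. (\<lambda>n. d n x) \<longlonglongrightarrow> f' x b"
    proof (rule AE_I2)
      fix x
      have "((\<lambda>t. (1/t) *\<^sub>R (f (x + t *\<^sub>R b) - f x)) \<longlongrightarrow> f' x b) (at 0)"
      proof (rule LIM_zero_cancel, rule tendsto_norm_zero_cancel)
        have *: "((\<lambda>t. norm (f (x + t *\<^sub>R b) - f x - t *\<^sub>R f' x b) / \<bar>t\<bar>) \<longlongrightarrow> 0) (at 0)"
          using line[of x 0] by (simp add: has_vector_derivative_def has_derivative_at)
        show "((\<lambda>t. norm ((1/t) *\<^sub>R (f (x + t *\<^sub>R b) - f x) - f' x b)) \<longlongrightarrow> 0) (at 0)"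
        proof (rule Lim_transform_eventually[OF *])
          have "norm (f (x + t *\<^sub>R b) - f x - t *\<^sub>R f' x b) / \<bar>t\<bar> =
              norm ((1/t) *\<^sub>R (f (x + t *\<^sub>R b) - f x) - f' x b)" if "t \<noteq> 0" for t
          proof -
            have "(1/t) *\<^sub>R (f (x + t *\<^sub>R b) - f x) - f' x b =
                (1/t) *\<^sub>R (f (x + t *\<^sub>R b) - f x - t *\<^sub>R f' x b)"
              using that by (simp add: scaleR_diff_right)
            then show ?thesis by simp
          qed
          then show "\<forall>\<^sub>F t in at 0. norm (f (x + t *\<^sub>R b) - f x - t *\<^sub>R f' x b) / \<bar>t\<bar> =
              norm ((1/t) *\<^sub>R (f (x + t *\<^sub>R b) - f x) - f' x b)"
            by (auto simp: eventually_at_filter)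
        qed
      qed
      moreover have "filterlim h (at 0) sequentially"
        using h by (auto simp: filterlim_at less_imp_neq[symmetric] intro!: always_eventually)
      ultimately show "(\<lambda>n. d n x) \<longlonglongrightarrow> f' x b"
        unfolding d_def by (rule filterlim_compose)
    qed
    show "AE x in lborel. norm (d n x) \<le> indicator K' x * B" for n
    proof (rule AE_I2)
      fix x
      show "norm (d n x) \<le> indicator K' x * B"
      proof (cases "x \<in> K'")
        case True
        have "norm (d n x) = norm (f (x + h n *\<^sub>R b) - f x) / h n"
          unfolding d_def norm_scaleR using h(2)[of n] by simp
        also have "\<dots> \<le> B"
          using lip[of x "h n"] h(2)[of n] by (simp add: pos_divide_le_eq)
        finally show ?thesis using True by simp
      next
        case False
        \<comment> \<open>The summand \<open>0 *\<^sub>R b\<close> lets \<open>inK'\<close> rule out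
          \<open>x\<close> itself as well as its translate.\<close>
        then have "x + h n *\<^sub>R b \<notin> K" "x + 0 *\<^sub>R b \<notin> K" using inK' h(2)[of n] h(3)[of n] by force+
        then show ?thesis using K(2) False by (simp add: d_def)
      qed
    qed
  qed
  then have "(LINT x|lborel. f' x b) = 0" by (simp add: dint LIMSEQ_const_iff)
  then show ?thesis
    by (simp add: integral_completion borel_measurable_continuous_onI[OF cont])
qed

subsection \<open>Test functions and the fundamental lemma\<close>

lemma C_k_imp_continuous: "C_k k f \<Longrightarrow> continuous_on UNIV f"
  by (cases k) (auto simp: differentiable_imp_continuous_within continuous_at_imp_continuous_on)

lemma C_k_SucI:
  assumes "\<And>x. (f has_derivative f' x) (at x)" "\<And>b. b \<in> Basis \<Longrightarrow> C_k k (\<lambda>x. f' x b)"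
  shows "C_k (Suc k) f"
proof -
  have "frechet_derivative f (at x) = f' x" for x
    using frechet_derivative_at[OF assms(1)] by simp
  then show ?thesis using assms by (auto simp: differentiable_def)
qed

lemma C_k_SucD: "C_k (Suc k) f \<Longrightarrow> C_k k f"
proof (induction k arbitrary: f)
  case 0
  then show ?case using C_k_imp_continuous[of "Suc 0" f] by simp
next
  case (Suc k)
  then show ?case by (subst C_k.simps) (metis C_k.simps(2))
qed

lemma C_k_add:
  assumes "C_k k f" "C_k k g" shows "C_k k (\<lambda>x. f x + g x)"
  using assms
proof (induction k arbitrary: f g)
  case 0
  then show ?case by (auto intro: continuous_on_add)
next
  case (Suc k)
  show ?case
  proof (rule C_k_SucI)
    show "((\<lambda>x. f x + g x) has_derivative
        (\<lambda>h. frechet_derivative f (at x) h + frechet_derivative g (at x) h)) (at x)" for x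
      using Suc.prems by (intro has_derivative_add) (auto simp: frechet_derivative_works[symmetric])
  qed (use Suc in auto)
qed

lemma C_k_mult:
  assumes "C_k k f" "C_k k g" shows "C_k k (\<lambda>x. f x * g x)"
  using assms
proof (induction k arbitrary: f g)
  case 0
  then show ?case by (auto intro: continuous_on_mult)
next
  case (Suc k)
  show ?case
  proof (rule C_k_SucI)
    show "((\<lambda>x. f x * g x) has_derivative
        (\<lambda>h. f x * frechet_derivative g (at x) h + frechet_derivative f (at x) h * g x)) (at x)" for x
      using Suc.prems by (intro has_derivative_mult) (auto simp: frechet_derivative_works[symmetric])
    show "C_k k (\<lambda>x. f x * frechet_derivative g (at x) b + frechet_derivative f (at x) b * g x)"
      if "b \<in> Basis" for b
      using that Suc.prems C_k_SucD[OF Suc.prems(1)] C_k_SucD[OF Suc.prems(2)]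
      by (intro C_k_add Suc.IH) auto
  qed
qed

lemma C_k_const: "C_k k (\<lambda>x. c)"
proof (induction k arbitrary: c)
  case (Suc k)
  show ?case by (rule C_k_SucI[where f'="\<lambda>x h. 0"]) (use Suc in auto)
qed auto

lemma C_k_prod: "(\<And>i. i \<in> I \<Longrightarrow> C_k k (f i)) \<Longrightarrow> C_k k (\<lambda>x. \<Prod>i\<in>I. f i x)"
  by (induction I rule: infinite_finite_induct) (auto intro: C_k_const C_k_mult)

text \<open>The derivatives of \<open>exp (- 1 / s)\<close>, extended by \<open>0\<close> to \<open>s \<le> 0\<close>, all have this shape.\<close>

definition flat :: "real poly \<Rightarrow> real \<Rightarrow> real" where
  "flat p s = (if s > 0 then poly p (1 / s) * exp (- (1 / s)) else 0)"

lemma poly_div_exp_tendsto_0: "((\<lambda>y::real. poly p y * exp (- y)) \<longlongrightarrow> 0) at_top"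
proof -
  have "((\<lambda>y. \<Sum>i\<le>degree p. coeff p i * (y ^ i / exp y)) \<longlongrightarrow> (\<Sum>i\<le>degree p. coeff p i * 0)) at_top"
    by (intro tendsto_sum tendsto_mult_left tendsto_power_div_exp_0)
  moreover have "poly p y * exp (- y) = (\<Sum>i\<le>degree p. coeff p i * (y ^ i / exp y))" for y
    by (simp add: poly_altdef exp_minus sum_distrib_right divide_inverse mult.assoc)
  ultimately show ?thesis by simp
qed

lemma flat_tendsto_0: "(flat p \<longlongrightarrow> 0) (at 0)"
proof -
  have "((\<lambda>s. poly p (inverse s) * exp (- (inverse s))) \<longlongrightarrow> 0) (at_right 0)"
    using filterlim_compose[OF poly_div_exp_tendsto_0 filterlim_inverse_at_top_right] .
  then have "(flat p \<longlongrightarrow> 0) (at_right 0)"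
    by (rule Lim_transform_eventually)
       (auto simp: flat_def eventually_at_filter inverse_eq_divide)
  moreover have "(flat p \<longlongrightarrow> 0) (at_left 0)"
    by (rule Lim_transform_eventually[OF tendsto_const]) (auto simp: flat_def eventually_at_filter)
  ultimately show ?thesis by (simp add: filterlim_split_at)
qed

text \<open>The chain rule at \<open>1 / s\<close> produces the factor \<open>1 / s\<^sup>2\<close>,
  which is \<open>monom 1 2\<close> evaluated at \<open>1 / s\<close>. The family is thus closed
  under differentiation, and smoothness follows by induction over all polynomials at once.\<close>

lemma flat_has_derivative:
  "(flat p has_real_derivative flat (monom 1 2 * (p - pderiv p)) s) (at s)"
proof -
  consider "s > 0" | "s < 0" | "s = 0" by linarith
  then show ?thesis
  proof cases
    case 1
    have "((\<lambda>s. poly p (1 / s) * exp (- (1 / s))) has_real_derivative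
        flat (monom 1 2 * (p - pderiv p)) s) (at s)"
      using 1 by (auto intro!: derivative_eq_intros DERIV_chain2[OF poly_DERIV]
          simp: flat_def poly_monom field_simps power2_eq_square)
    then show ?thesis
      by (rule has_field_derivative_transform_within_open[where S="{0<..}"]) (use 1 in \<open>auto simp: flat_def\<close>)
  next
    case 2
    have "((\<lambda>s. 0) has_real_derivative flat (monom 1 2 * (p - pderiv p)) s) (at s)"
      using 2 by (simp add: flat_def)
    then show ?thesis
      by (rule has_field_derivative_transform_within_open[where S="{..<0}"]) (use 2 in \<open>auto simp: flat_def\<close>)
  next
    case 3
    \<comment> \<open>The difference quotient at 0 is again a flat function: dividing by
      \<open>h\<close> multiplies the polynomial by \<open>monom 1 1\<close>.\<close>
    have "((\<lambda>h. (flat p (0 + h) - flat p 0) / h) \<longlongrightarrow> 0) (at 0)"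
      by (rule Lim_transform_eventually[OF flat_tendsto_0[of "monom 1 1 * p"]])
         (auto simp: flat_def eventually_at_filter poly_monom)
    then show ?thesis using 3 by (simp add: DERIV_def flat_def)
  qed
qed

lemma C_k_flat_affine: "C_k k (\<lambda>x::'a::euclidean_space. flat p (x \<bullet> v + c))"
proof (induction k arbitrary: p)
  case 0
  have "continuous_on UNIV (flat p)"
    using flat_has_derivative DERIV_isCont continuous_at_imp_continuous_on by blast
  then have "continuous_on UNIV (\<lambda>x::'a. flat p (x \<bullet> v + c))"
    by (rule continuous_on_compose2) (auto intro!: continuous_intros)
  then show ?case by simp
next
  case (Suc k)
  show ?case
  proof (rule C_k_SucI)
    fix x :: 'a
    show "((\<lambda>x. flat p (x \<bullet> v + c)) has_derivative
        (\<lambda>h. flat (monom 1 2 * (p - pderiv p)) (x \<bullet> v + c) * (h \<bullet> v))) (at x)"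
      by (rule has_derivative_compose[OF _ flat_has_derivative[unfolded has_field_derivative_def]])
         (auto intro!: derivative_eq_intros)
  qed (intro C_k_mult Suc C_k_const)
qed

text \<open>Since \<open>flat 1 (k * s)\<close> is the \<open>k\<close>-th root of \<open>flat 1 s\<close>, these functions increase to the
  indicator of the box as \<open>k\<close> grows.\<close>

definition box_bump :: "'a::euclidean_space \<Rightarrow> 'a \<Rightarrow> real \<Rightarrow> 'a \<Rightarrow> real" where
  "box_bump a b k x = (\<Prod>i\<in>Basis. flat 1 (x \<bullet> (k *\<^sub>R i) + - k * (a \<bullet> i)) * flat 1 (x \<bullet> (- k *\<^sub>R i) + k * (b \<bullet> i)))"

lemma flat_1_bounds: "0 \<le> flat 1 s" "flat 1 s \<le> 1"
  by (auto simp: flat_def)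

lemma box_bump_bounds: "0 \<le> box_bump a b k x" "box_bump a b k x \<le> 1"
  unfolding box_bump_def
  by (auto intro!: prod_nonneg prod_le_1 mult_le_one simp: flat_1_bounds)

lemma box_bump_eq_0:
  assumes "k > 0" "x \<notin> box a b" shows "box_bump a b k x = 0"
proof -
  obtain i where i: "i \<in> Basis" "x \<bullet> i \<le> a \<bullet> i \<or> b \<bullet> i \<le> x \<bullet> i"
    using assms(2) by (auto simp: mem_box not_less)
  then have "flat 1 (x \<bullet> (k *\<^sub>R i) + - k * (a \<bullet> i)) * flat 1 (x \<bullet> (- k *\<^sub>R i) + k * (b \<bullet> i)) = 0"
    using assms(1) by (auto simp: flat_def mult_less_cancel_left)
  then show ?thesis unfolding box_bump_def using i(1) by (auto simp: prod_zero_iff)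
qed

lemma test_function_box_bump:
  assumes "k > 0" shows "test_function (box_bump a b k)"
proof -
  have "{x. box_bump a b k x \<noteq> 0} \<subseteq> cbox a b"
    using box_bump_eq_0[OF assms] box_subset_cbox by blast
  then have "bounded {x. box_bump a b k x \<noteq> 0}"
    using bounded_cbox bounded_subset by blast
  moreover have "C_k m (box_bump a b k)" for m
    unfolding box_bump_def[abs_def] by (intro C_k_prod C_k_mult C_k_flat_affine)
  ultimately show ?thesis by (simp add: test_function_def)
qed

lemma box_bump_tendsto_indicator:
  "(\<lambda>n. box_bump a b (real (Suc n)) x) \<longlonglongrightarrow> indicator (box a b) x"
proof (cases "x \<in> box a b")
  case True
  have lim: "(\<lambda>n. flat 1 (real (Suc n) * d)) \<longlonglongrightarrow> 1" if "d > 0" for d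
  proof -
    have "(\<lambda>n. exp (- ((1 / d) * inverse (real (Suc n))))) \<longlonglongrightarrow> exp (- ((1 / d) * 0))"
      by (intro tendsto_intros LIMSEQ_inverse_real_of_nat)
    moreover have "flat 1 (real (Suc n) * d) = exp (- ((1 / d) * inverse (real (Suc n))))" for n
      using that by (simp add: flat_def field_simps del: of_nat_Suc)
    ultimately show ?thesis by simp
  qed
  have "(\<lambda>n. \<Prod>i\<in>Basis. flat 1 (real (Suc n) * (x \<bullet> i - a \<bullet> i)) * flat 1 (real (Suc n) * (b \<bullet> i - x \<bullet> i)))
      \<longlonglongrightarrow> (\<Prod>i\<in>(Basis::'a set). 1 * 1)"
    using True by (intro tendsto_prod tendsto_mult lim) (auto simp: mem_box)
  then show ?thesis using True
    by (simp add: box_bump_def algebra_simps del: of_nat_Suc)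
next
  case False
  then show ?thesis by (simp add: box_bump_eq_0 del: of_nat_Suc)
qed

section \<open>The fundamental lemma of the calculus of variations\<close>

lemma locally_integrable_borel_measurable:
  fixes g :: "'a::euclidean_space \<Rightarrow> 'b::{banach, second_countable_topology}"
  assumes "locally_integrable g" shows "g \<in> borel_measurable lebesgue"
proof (rule borel_measurable_LIMSEQ_metric)
  \<comment> \<open>Truncations to growing balls are integrable, hence measurable, and at each point
    they eventually agree with \<open>g\<close>.\<close>
  show "(\<lambda>x. indicator (cball 0 (real n)) x *\<^sub>R g x) \<in> borel_measurable lebesgue" for n
    using assms by (auto simp: locally_integrable_def set_integrable_def intro!: borel_measurable_integrable)
  show "(\<lambda>n. indicator (cball 0 (real n)) x *\<^sub>R g x) \<longlonglongrightarrow> g x" for x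
  proof (rule tendsto_eventually)
    obtain N where "norm x \<le> real N" using real_arch_simple by blast
    then show "\<forall>\<^sub>F n in sequentially. indicator (cball 0 (real n)) x *\<^sub>R g x = g x"
      by (intro eventually_sequentiallyI[of N]) (auto simp: indicator_def)
  qed
qed

lemma mem_box_One_if_norm_less:
  assumes "norm x < r" shows "x \<in> box (- r *\<^sub>R One) (r *\<^sub>R One)"
proof -
  have "\<bar>x \<bullet> i\<bar> < r" if "i \<in> Basis" for i
    using Basis_le_norm[OF that, of x] assms by linarith
  then show ?thesis by (simp add: mem_box abs_less_iff minus_less_iff)
qed

lemma sigma_finite_lebesgue: "sigma_finite_measure (lebesgue :: 'a::euclidean_space measure)"
proof
  obtain A :: "'a set set" where "countable A" "A \<subseteq> sets lborel" "\<Union> A = space lborel" "\<forall>a\<in>A. emeasure lborel a \<noteq> \<infinity>"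
    using lborel.sigma_finite_countable by blast
  then show "\<exists>A::'a set set. countable A \<and> A \<subseteq> sets lebesgue \<and> \<Union> A = space lebesgue \<and> (\<forall>a\<in>A. emeasure lebesgue a \<noteq> \<infinity>)"
    by (intro exI[of _ A]) (auto simp: sets_completionI_sets subset_eq)
qed

text \<open>Boxes are stable under intersection and generate the Borel sets, and the sets over which
  \<open>g\<close> integrates to 0 form a Dynkin system. A function whose integral vanishes over
  every measurable set is zero almost everywhere.\<close>

lemma AE_zero_if_box_integrals_zero:
  fixes g :: "'a::euclidean_space \<Rightarrow> 'b::{banach, second_countable_topology}"
  assumes g: "integrable lebesgue g" and box: "\<And>a b. (LINT x:box a b|lebesgue. g x) = 0"
  shows "AE x in lebesgue. g x = 0"
proof (rule sigma_finite_measure.density_zero[OF sigma_finite_lebesgue g])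
  \<comment> \<open>The complement step of the Dynkin argument needs the integral over the whole
    space, obtained by exhausting it with boxes.\<close>
  have "(LINT x|lebesgue. g x) = 0"
  proof (rule LIMSEQ_unique)
    have "(\<lambda>n. LINT x|lebesgue. indicator (box (- real n *\<^sub>R One) (real n *\<^sub>R One)) x *\<^sub>R g x)
        \<longlonglongrightarrow> (LINT x|lebesgue. g x)"
    proof (rule integral_dominated_convergence[where w="\<lambda>x. norm (g x)"])
      have "(\<lambda>n. indicator (box (- real n *\<^sub>R One) (real n *\<^sub>R One)) x *\<^sub>R g x) \<longlonglongrightarrow> g x" for x
      proof (rule tendsto_eventually)
        obtain N where "norm x < real N" using reals_Archimedean2 by blast
        then have "x \<in> box (- real n *\<^sub>R One) (real n *\<^sub>R One)" if "n \<ge> N" for n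
          using that by (intro mem_box_One_if_norm_less) simp
        then show "\<forall>\<^sub>F n in sequentially. indicator (box (- real n *\<^sub>R One) (real n *\<^sub>R One)) x *\<^sub>R g x = g x"
          by (intro eventually_sequentiallyI[of N]) auto
      qed
      then show "AE x in lebesgue. (\<lambda>n. indicator (box (- real n *\<^sub>R One) (real n *\<^sub>R One)) x *\<^sub>R g x) \<longlonglongrightarrow> g x"
        by blast
      show "(\<lambda>x. indicator (box (- real n *\<^sub>R One) (real n *\<^sub>R One)) x *\<^sub>R g x) \<in> borel_measurable lebesgue" for n
        by (intro borel_measurable_scaleR borel_measurable_indicator borel_measurable_integrable[OF g]) auto
    qed (use g in \<open>auto simp: indicator_def\<close>)
    then show "(\<lambda>n. 0) \<longlonglongrightarrow> (LINT x|lebesgue. g x)"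
      using box by (simp add: set_lebesgue_integral_def)
  qed auto
  note all = this
  have borel: "set_lebesgue_integral lebesgue A g = 0" if "A \<in> sets lborel" for A
  proof -
    have "Int_stable (range (\<lambda>(a, b). box a b :: 'a set))"
      by (auto simp: Int_stable_def box_Int_box)
    moreover have "range (\<lambda>(a, b). box a b :: 'a set) \<subseteq> Pow UNIV" by simp
    moreover have "A \<in> sigma_sets UNIV (range (\<lambda>(a, b). box a b))"
      using that by (simp add: borel_eq_box)
    ultimately show ?thesis
    proof (induction rule: sigma_sets_induct_disjoint)
      case (compl A)
      then have A: "A \<in> sets lebesgue" by (simp add: borel_eq_box sets_completionI_sets)
      then have gA: "set_integrable lebesgue A g"
        using g by (simp add: set_integrable_def integrable_mult_indicator)
      have "(LINT x:UNIV - A|lebesgue. g x) = (LINT x|lebesgue. g x - indicator A x *\<^sub>R g x)"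
        unfolding set_lebesgue_integral_def by (rule Bochner_Integration.integral_cong) (auto simp: indicator_def)
      also have "\<dots> = 0"
        using g gA compl all by (simp add: set_integrable_def set_lebesgue_integral_def)
      finally show ?case .
    next
      case (union A)
      have A: "A i \<in> sets lebesgue" for i
        using union(2) by (intro sets_completionI_sets) (auto simp: borel_eq_box image_subset_iff)
      have "(LINT x:(\<Union>i. A i)|lebesgue. g x) = (\<Sum>i. (LINT x:A i|lebesgue. g x))"
      proof (rule lebesgue_integral_countable_add)
        show "set_integrable lebesgue (\<Union>i. A i) g"
          using g A by (auto simp: set_integrable_def intro!: integrable_mult_indicator)
      qed (use A union in \<open>auto simp: disjoint_family_on_def\<close>)
      then show ?case using union by simp
    qed (use box in \<open>auto simp: set_lebesgue_integral_def\<close>)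
  qed
  fix A :: "'a set" assume A: "A \<in> sets lebesgue"
  \<comment> \<open>A Lebesgue set differs from a Borel set only inside a null set, so the Borel
    case suffices.\<close>
  then obtain S N N' where S: "A = S \<union> N" "N \<subseteq> N'" "N' \<in> null_sets lborel" "S \<in> sets lborel"
    by (rule sets_completionE)
  have "AE x in lebesgue. x \<notin> N'"
    using S(3) by (intro AE_completion AE_not_in)
  then have "AE x in lebesgue. indicator A x *\<^sub>R g x = indicator S x *\<^sub>R g x"
    by eventually_elim (use S in \<open>auto simp: indicator_def\<close>)
  moreover have "g \<in> borel_measurable lebesgue" "S \<in> sets lebesgue"
    using g S(4) by auto
  ultimately have "set_lebesgue_integral lebesgue A g = set_lebesgue_integral lebesgue S g"
    unfolding set_lebesgue_integral_def using A
    by (intro integral_cong_AE borel_measurable_scaleR borel_measurable_indicator)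
  then show "set_lebesgue_integral lebesgue A g = 0" using borel[OF S(4)] by simp
qed

text \<open>The functions \<open>box_bump\<close> are test functions that converge to the indicator
  of a box, so all box integrals of \<open>g\<close> vanish.\<close>

lemma AE_zero_if_test_integrals_zero:
  fixes g :: "'a::euclidean_space \<Rightarrow> 'b::euclidean_space"
  assumes g: "locally_integrable g"
    and zero: "\<And>\<phi>. test_function \<phi> \<Longrightarrow> (LINT x|lebesgue. \<phi> x *\<^sub>R g x) = 0"
  shows "AE x in lebesgue. g x = 0"
proof -
  note gm[measurable] = locally_integrable_borel_measurable[OF g]
  have box: "(LINT x:box a b|lebesgue. g x) = 0" for a b
  proof -
    have "(\<lambda>n. LINT x|lebesgue. box_bump a b (real (Suc n)) x *\<^sub>R g x) \<longlonglongrightarrow>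
        (LINT x|lebesgue. indicator (box a b) x *\<^sub>R g x)"
    proof (rule integral_dominated_convergence[where w="\<lambda>x. norm (indicator (cbox a b) x *\<^sub>R g x)"])
      show "integrable lebesgue (\<lambda>x. norm (indicator (cbox a b) x *\<^sub>R g x))"
        using g compact_cbox[of a b] by (intro integrable_norm) (auto simp: locally_integrable_def set_integrable_def)
      show "AE x in lebesgue. (\<lambda>n. box_bump a b (real (Suc n)) x *\<^sub>R g x) \<longlonglongrightarrow> indicator (box a b) x *\<^sub>R g x"
        by (intro AE_I2 tendsto_scaleR box_bump_tendsto_indicator tendsto_const)
      show "(\<lambda>x. box_bump a b (real (Suc n)) x *\<^sub>R g x) \<in> borel_measurable lebesgue" for n
      proof -
        have "continuous_on UNIV (box_bump a b (real (Suc n)))"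
          using test_function_box_bump[of "real (Suc n)" a b] C_k_imp_continuous[of 0] 
          unfolding test_function_def by (metis of_nat_0_less_iff zero_less_Suc)
        then have "box_bump a b (real (Suc n)) \<in> borel_measurable lebesgue"
          by (intro measurable_completion) (simp add: borel_measurable_continuous_onI)
        then show ?thesis by measurable
      qed
      show "AE x in lebesgue. norm (box_bump a b (real (Suc n)) x *\<^sub>R g x) \<le> norm (indicator (cbox a b) x *\<^sub>R g x)" for n
      proof (rule AE_I2)
        fix x
        show "norm (box_bump a b (real (Suc n)) x *\<^sub>R g x) \<le> norm (indicator (cbox a b) x *\<^sub>R g x)"
        proof (cases "x \<in> box a b")
          case True
          then have "x \<in> cbox a b" using box_subset_cbox by blast
          then show ?thesis 
            using box_bump_bounds[of a b "real (Suc n)" x] by (auto intro: mult_left_le_one_le)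
        next
          case False
          then show ?thesis by (subst box_bump_eq_0) auto
        qed
      qed
    qed (auto intro!: borel_measurable_scaleR borel_measurable_indicator)
    then show ?thesis
      using zero[OF test_function_box_bump] LIMSEQ_unique[OF _ tendsto_const]
      by (simp add: set_lebesgue_integral_def del: of_nat_Suc) 
  qed
  \<comment> \<open>Since \<open>g\<close> is only locally integrable, it is cut off to a box before
    the criterion for integrable functions applies. The intersection of two boxes is a box, so the
    cut-off function still has zero box integrals.\<close>
  have "AE x in lebesgue. indicator (box (- real n *\<^sub>R One) (real n *\<^sub>R One)) x *\<^sub>R g x = 0" for n
  proof (rule AE_zero_if_box_integrals_zero)
    let ?C = "box (- real n *\<^sub>R One) (real n *\<^sub>R One) :: 'a set"
    show "integrable lebesgue (\<lambda>x. indicator ?C x *\<^sub>R g x)"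
    proof -
      have "set_integrable lebesgue (cbox (- real n *\<^sub>R One) (real n *\<^sub>R One)) g"
        using g compact_cbox unfolding locally_integrable_def by blast
      then have "set_integrable lebesgue ?C g"
        by (rule set_integrable_subset) (auto simp: box_subset_cbox)
      then show ?thesis by (simp add: set_integrable_def)
    qed
    fix a b :: 'a
    obtain c d where "box a b \<inter> ?C = box c d" by (rule that[OF box_Int_box])
    then have "(LINT x:box a b|lebesgue. indicator ?C x *\<^sub>R g x) = (LINT x:box c d|lebesgue. g x)"
      by (simp add: set_lebesgue_integral_def indicator_inter_arith[symmetric])
    then show "(LINT x:box a b|lebesgue. indicator ?C x *\<^sub>R g x) = 0" using box by simp
  qed
  then have "AE x in lebesgue. \<forall>n. indicator (box (- real n *\<^sub>R One) (real n *\<^sub>R One)) x *\<^sub>R g x = 0"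
    unfolding AE_all_countable by blast
  then show ?thesis
  proof eventually_elim
    case (elim x)
    obtain n where "norm x < real n" using reals_Archimedean2 by blast
    then have "x \<in> box (- real n *\<^sub>R One) (real n *\<^sub>R One)"
      by (rule mem_box_One_if_norm_less)
    then show ?case using elim by (auto dest: spec[of _ n])
  qed
qed

subsection \<open>Weak derivatives of continuously differentiable functions\<close>

lemma integrable_test_scaleR:
  fixes g :: "'a::euclidean_space \<Rightarrow> 'b::{banach, second_countable_topology}"
  assumes "test_function \<phi>" "locally_integrable g"
  shows "integrable lebesgue (\<lambda>x. \<phi> x *\<^sub>R g x)"
proof -
  define K where "K = closure {x. \<phi> x \<noteq> 0}"
  have K: "compact K" "\<And>x. x \<notin> K \<Longrightarrow> \<phi> x = 0"
    using assms(1) closure_subset[of "{x. \<phi> x \<noteq> 0}"] by (auto simp: K_def test_function_def)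
  have cont: "continuous_on UNIV \<phi>"
    using assms(1) C_k_imp_continuous by (auto simp: test_function_def)
  obtain B where B: "B > 0" "\<And>x. norm (\<phi> x) \<le> B"
    using continuous_compact_support_bounded[OF cont K] by blast
  have "integrable lebesgue (\<lambda>x. B *\<^sub>R (indicator K x *\<^sub>R g x))"
    by (intro integrable_scaleR_right)
       (use assms(2) K(1) in \<open>auto simp: locally_integrable_def set_integrable_def\<close>)
  then show ?thesis
  proof (rule Bochner_Integration.integrable_bound)
    have "\<phi> \<in> borel_measurable lebesgue"
      using cont by (intro measurable_completion) (simp add: borel_measurable_continuous_onI)
    then show "(\<lambda>x. \<phi> x *\<^sub>R g x) \<in> borel_measurable lebesgue"
      using locally_integrable_borel_measurable[OF assms(2)] by (rule borel_measurable_scaleR)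
    show "AE x in lebesgue. norm (\<phi> x *\<^sub>R g x) \<le> norm (B *\<^sub>R (indicator K x *\<^sub>R g x))"
    proof (rule AE_I2)
      fix x
      show "norm (\<phi> x *\<^sub>R g x) \<le> norm (B *\<^sub>R (indicator K x *\<^sub>R g x))"
        using B(1) B(2)[of x] K(2)[of x] by (cases "x \<in> K") (auto intro: mult_right_mono)
    qed
  qed
qed

lemma continuous_imp_locally_integrable:
  fixes f :: "'a::euclidean_space \<Rightarrow> 'b::euclidean_space"
  assumes "continuous_on UNIV f" shows "locally_integrable f"
  unfolding locally_integrable_def set_integrable_def
proof (intro allI impI)
  fix K :: "'a set" assume K: "compact K"
  have i: "integrable lborel (\<lambda>x. indicator K x *\<^sub>R f x)"
    by (rule borel_integrable_compact[OF K continuous_on_subset[OF assms]]) auto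
  then show "integrable lebesgue (\<lambda>x. indicator K x *\<^sub>R f x)"
    by (subst integrable_completion) (auto intro: borel_measurable_integrable)
qed

text \<open>Both candidates have the same integral against every test function, so their difference
  falls under the fundamental lemma.\<close>

lemma is_weak_pderiv_unique:
  assumes g: "is_weak_pderiv b w g" and g': "is_weak_pderiv b w g'"
  shows "AE x in lebesgue. g x = g' x"
proof -
  have loc: "locally_integrable g" "locally_integrable g'"
    using g g' by (auto simp: is_weak_pderiv_def)
  have "AE x in lebesgue. g x - g' x = 0"
  proof (rule AE_zero_if_test_integrals_zero)
    show "locally_integrable (\<lambda>x. g x - g' x)"
      using loc by (simp add: locally_integrable_def set_integral_diff)
    fix \<phi> :: "'a \<Rightarrow> real" assume \<phi>: "test_function \<phi>"
    have "(LINT x|lebesgue. \<phi> x *\<^sub>R (g x - g' x)) =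
        (LINT x|lebesgue. \<phi> x *\<^sub>R g x) - (LINT x|lebesgue. \<phi> x *\<^sub>R g' x)"
      unfolding scaleR_right_diff_distrib
      by (intro Bochner_Integration.integral_diff integrable_test_scaleR[OF \<phi>] loc)
    also have "\<dots> = 0"
      using g g' \<phi> by (simp add: is_weak_pderiv_def)
    finally show "(LINT x|lebesgue. \<phi> x *\<^sub>R (g x - g' x)) = 0" .
  qed
  then show ?thesis by simp
qed

text \<open>A test function times \<open>u\<close> has compact support, so the integral of its
  derivative in direction \<open>b\<close> vanishes. The product rule splits this integral into the
  two sides of the defining identity.\<close>

lemma is_weak_pderiv_C1:
  assumes b: "b \<in> Basis"
    and der: "\<And>x. (u has_derivative u' x) (at x)"
    and cont: "continuous_on UNIV (\<lambda>x. u' x b)"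
  shows "is_weak_pderiv b u (\<lambda>x. u' x b)"
  unfolding is_weak_pderiv_def
proof (intro conjI allI impI)
  have contu: "continuous_on UNIV u"
    by (intro continuous_at_imp_continuous_on ballI has_derivative_continuous[OF der])
  then show "locally_integrable u" by (rule continuous_imp_locally_integrable)
  show loc: "locally_integrable (\<lambda>x. u' x b)" using cont by (rule continuous_imp_locally_integrable)
  fix \<phi> :: "'a \<Rightarrow> real" assume \<phi>: "test_function \<phi>"
  define K where "K = closure {x. \<phi> x \<noteq> 0}"
  have K: "compact K" "\<And>x. x \<notin> K \<Longrightarrow> \<phi> x = 0"
    using \<phi> closure_subset[of "{x. \<phi> x \<noteq> 0}"] by (auto simp: K_def test_function_def)
  have "C_k 1 \<phi>" using \<phi> by (simp add: test_function_def)
  then have dphi: "\<And>x. (\<phi> has_derivative frechet_derivative \<phi> (at x)) (at x)"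
    and cdphi: "continuous_on UNIV (\<lambda>x. frechet_derivative \<phi> (at x) b)"
    using b by (auto simp: frechet_derivative_works[symmetric])
  have cphi: "continuous_on UNIV \<phi>"
    using \<phi> C_k_imp_continuous by (auto simp: test_function_def)
  have dzero: "frechet_derivative \<phi> (at x) b = 0" if "x \<notin> K" for x
  proof -
    have "open (- K)" using K(1) compact_imp_closed by blast
    then have "((\<lambda>x. 0) has_derivative frechet_derivative \<phi> (at x)) (at x)"
      using has_derivative_transform_within_open[OF dphi, of "-K" x "\<lambda>x. 0"] that K(2) by auto
    then have "frechet_derivative \<phi> (at x) = (\<lambda>x. 0)"
      using has_derivative_const has_derivative_unique by blast
    then show ?thesis by simp
  qed
  define F' where "F' x h = \<phi> x *\<^sub>R u' x h + frechet_derivative \<phi> (at x) h *\<^sub>R u x" for x h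
  have "(LINT x|lebesgue. F' x b) = 0"
  proof (rule integral_directional_derivative_zero[OF _ _ K(1)])
    show "((\<lambda>x. \<phi> x *\<^sub>R u x) has_derivative F' x) (at x)" for x
      unfolding F'_def by (rule has_derivative_scaleR[OF dphi der])
    show "continuous_on UNIV (\<lambda>x. F' x b)"
      unfolding F'_def by (intro continuous_intros cphi cdphi contu cont)
  qed (use K(2) in auto)
  moreover have "integrable lebesgue (\<lambda>x. frechet_derivative \<phi> (at x) b *\<^sub>R u x)"
    by (rule integrable_continuous_compact_support(2)[OF _ K(1)])
       (use dzero in \<open>auto intro!: continuous_intros cdphi contu\<close>)
  ultimately show "(LINT x|lebesgue. frechet_derivative \<phi> (at x) b *\<^sub>R u x) =
      - (LINT x|lebesgue. \<phi> x *\<^sub>R u' x b)"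
    using integrable_test_scaleR[OF \<phi> loc] by (simp add: F'_def eq_neg_iff_add_eq_0 add.commute)
qed

lemma AE_weak_pderiv_eq:
  assumes "is_weak_pderiv b w g" shows "AE x in lebesgue. weak_pderiv b w x = g x"
  using is_weak_pderiv_unique[OF someI[of "is_weak_pderiv b w", OF assms] assms]
  by (simp add: weak_pderiv_def)

lemma integral_weak_grad_norm_sq:
  assumes g: "\<And>b. b \<in> Basis \<Longrightarrow> is_weak_pderiv b w (g b)"
  shows "(LINT x|lebesgue. weak_grad_norm_sq w x) = (LINT x|lebesgue. (\<Sum>b\<in>Basis. (norm (g b x))\<^sup>2))"
proof (rule integral_cong_AE)
  have "AE x in lebesgue. \<forall>b\<in>Basis. weak_pderiv b w x = g b x"
    using g by (intro AE_finite_allI AE_weak_pderiv_eq) auto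
  then show ae: "AE x in lebesgue. weak_grad_norm_sq w x = (\<Sum>b\<in>Basis. (norm (g b x))\<^sup>2)"
    by eventually_elim (simp add: weak_grad_norm_sq_def)
  have "g b \<in> borel_measurable lebesgue" if "b \<in> Basis" for b
    using g[OF that] locally_integrable_borel_measurable by (auto simp: is_weak_pderiv_def)
  then show m: "(\<lambda>x. \<Sum>b\<in>Basis. (norm (g b x))\<^sup>2) \<in> borel_measurable lebesgue"
    by (intro borel_measurable_sum borel_measurable_power borel_measurable_norm) auto
  \<comment> \<open>Measurability passes from the concrete derivatives to the chosen ones across
    almost everywhere equality, by completeness of \<open>lebesgue\<close>.\<close>
  show "weak_grad_norm_sq w \<in> borel_measurable lebesgue"
    by (rule borel_measurable_AE[OF m]) (use ae in \<open>auto elim: eventually_mono\<close>)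
qed

text \<open>Serves for \<open>W12\<close> with weight 1, for \<open>L2 V\<close>, and as the source
  of integrability of \<open>V\<close> times a squared bump.\<close>

lemma continuous_compact_support_in_L2:
  assumes "continuous_on UNIV u" "compact K" "\<And>x. x \<notin> K \<Longrightarrow> u x = 0" "locally_integrable V"
  shows "u \<in> L2 V"
proof -
  obtain B where B: "B > 0" "\<And>x. norm (u x) \<le> B"
    using continuous_compact_support_bounded[OF assms(1-3)] by blast
  have um: "u \<in> borel_measurable lebesgue"
    using assms(1) by (intro measurable_completion) (simp add: borel_measurable_continuous_onI)
  have "integrable lebesgue (\<lambda>x. B\<^sup>2 * (indicator K x *\<^sub>R V x))"
    using assms(4,2) by (auto simp: locally_integrable_def set_integrable_def)
  then have "integrable lebesgue (\<lambda>x. V x * (norm (u x))\<^sup>2)"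
  proof (rule Bochner_Integration.integrable_bound)
    show "(\<lambda>x. V x * (norm (u x))\<^sup>2) \<in> borel_measurable lebesgue"
      using um locally_integrable_borel_measurable[OF assms(4)] by measurable
    show "AE x in lebesgue. norm (V x * (norm (u x))\<^sup>2) \<le> norm (B\<^sup>2 * (indicator K x *\<^sub>R V x))"
    proof (rule AE_I2)
      fix x
      have "(norm (u x))\<^sup>2 \<le> B\<^sup>2" using B by (intro power_mono) auto
      then show "norm (V x * (norm (u x))\<^sup>2) \<le> norm (B\<^sup>2 * (indicator K x *\<^sub>R V x))"
        using assms(3)[of x] by (cases "x \<in> K") (auto simp: abs_mult mult.commute intro: mult_left_mono)
    qed
  qed
  then show ?thesis using um by (simp add: L2_def)
qed

lemma C1_compact_support_in_W12:
  assumes der: "\<And>x. (u has_derivative u' x) (at x)"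
    and cont: "\<And>b. b \<in> Basis \<Longrightarrow> continuous_on UNIV (\<lambda>x. u' x b)"
    and K: "compact K" "\<And>x. x \<notin> K \<Longrightarrow> u x = 0" "\<And>x b. x \<notin> K \<Longrightarrow> u' x b = 0"
  shows "u \<in> W12"
proof -
  have one: "locally_integrable (\<lambda>_. 1 :: real)"
    by (rule continuous_imp_locally_integrable) auto
  have "continuous_on UNIV u"
    by (intro continuous_at_imp_continuous_on ballI has_derivative_continuous[OF der])
  then have "u \<in> L2 (\<lambda>_. 1)"
    by (rule continuous_compact_support_in_L2[OF _ K(1,2) one])
  moreover have "(\<lambda>x. u' x b) \<in> L2 (\<lambda>_. 1)" "is_weak_pderiv b u (\<lambda>x. u' x b)" if "b \<in> Basis" for b
    using continuous_compact_support_in_L2[OF cont[OF that] K(1,3) one] is_weak_pderiv_C1[OF that der cont[OF that]]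
    by auto
  ultimately show ?thesis by (auto simp: W12_def)
qed

subsection \<open>Logarithmic bumps on annuli\<close>

text \<open>The outer square smooths the corners of the positive part at both ends. The origin is
  treated separately because \<open>ln 0\<close> is a mere default value, which may lie between
  \<open>a\<close> and \<open>b\<close>.\<close>

definition annular_bump :: "real \<Rightarrow> real \<Rightarrow> 'a::euclidean_space \<Rightarrow> real" where
  "annular_bump a b x =
     (if x = 0 then 0 else (max 0 ((ln (norm x) - a) * (b - ln (norm x))))\<^sup>2)"

text \<open>The gradient of \<open>annular_bump a b\<close> at \<open>x\<close> is \<open>annular_slope a b x *\<^sub>R x\<close>, which at \<open>x = 0\<close>
  relies on \<open>y / 0 = 0\<close>.\<close>

definition annular_slope :: "real \<Rightarrow> real \<Rightarrow> 'a::euclidean_space \<Rightarrow> real" where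
  "annular_slope a b x =
     2 * max 0 ((ln (norm x) - a) * (b - ln (norm x))) * (a + b - 2 * ln (norm x)) / (norm x)\<^sup>2"

lemma pos_part_square_has_derivative:
  "((\<lambda>s::real. (max 0 s)\<^sup>2) has_real_derivative 2 * max 0 s) (at s)"
proof -
  consider "s > 0" | "s < 0" | "s = 0" by linarith
  then show ?thesis
  proof cases
    case 1
    have "((\<lambda>s. s\<^sup>2) has_real_derivative 2 * max 0 s) (at s)"
      using 1 by (auto intro!: derivative_eq_intros)
    then show ?thesis
      by (rule has_field_derivative_transform_within_open[where S="{0<..}"]) (use 1 in auto)
  next
    case 2
    have "((\<lambda>s. 0) has_real_derivative 2 * max 0 s) (at s)"
      using 2 by simp
    then show ?thesis
      by (rule has_field_derivative_transform_within_open[where S="{..<0}"]) (use 2 in auto)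
  next
    case 3
    have "((\<lambda>h. max 0 h) \<longlongrightarrow> max 0 (0::real)) (at 0)"
      by (intro tendsto_intros)
    then have "((\<lambda>h. max 0 h) \<longlongrightarrow> (0::real)) (at 0)" by simp
    then have "((\<lambda>h::real. ((max 0 (0 + h))\<^sup>2 - (max 0 0)\<^sup>2) / h) \<longlongrightarrow> 0) (at 0)"
      by (rule Lim_transform_eventually) (auto simp: eventually_at_filter max_def power2_eq_square)
    then show ?thesis using 3 by (simp add: DERIV_def)
  qed
qed

text \<open>Two negative factors would put \<open>ln (norm x)\<close> below \<open>a\<close> and
  above \<open>b\<close> at once.\<close>

lemma log_interval_iff:
  fixes x :: "'a::euclidean_space"
  assumes "a < b" "x \<noteq> 0"
  shows "(ln (norm x) - a) * (b - ln (norm x)) > 0 \<longleftrightarrow> exp a < norm x \<and> norm x < exp b"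
proof -
  have "exp a < norm x \<longleftrightarrow> a < ln (norm x)" "norm x < exp b \<longleftrightarrow> ln (norm x) < b"
    using assms(2) by (auto simp: exp_less_cancel_iff[symmetric, of _ "ln (norm x)"]
      exp_less_cancel_iff[symmetric, of "ln (norm x)"] simp del: exp_less_cancel_iff)
  then show ?thesis using assms(1) by (auto simp: zero_less_mult_iff)
qed

lemma annular_zero:
  fixes x :: "'a::euclidean_space"
  assumes "a < b" "\<not> (exp a < norm x \<and> norm x < exp b)"
  shows "annular_bump a b x = 0" "annular_slope a b x = 0"
proof -
  have "max 0 ((ln (norm x) - a) * (b - ln (norm x))) = 0" if "x \<noteq> 0"
    using log_interval_iff[OF assms(1) that] assms(2) by linarith
  then show "annular_bump a b x = 0" "annular_slope a b x = 0"
    by (auto simp: annular_bump_def annular_slope_def)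
qed

lemma annular_bump_pos:
  fixes x :: "'a::euclidean_space"
  assumes "a < b" "exp a < norm x" "norm x < exp b"
  shows "annular_bump a b x > 0"
proof -
  have "x \<noteq> 0" using assms(2) less_trans[OF exp_gt_zero] by force
  then have "max 0 ((ln (norm x) - a) * (b - ln (norm x))) > 0"
    using log_interval_iff[OF assms(1)] assms(2,3) by (meson less_max_iff_disj)
  then show ?thesis
    using \<open>x \<noteq> 0\<close> by (simp only: annular_bump_def if_False zero_less_power)
qed

text \<open>Away from the origin this is the chain rule, the gradient of \<open>ln (norm x)\<close>
  being \<open>x\<close> divided by the square of its norm. At the origin the bump vanishes on a
  whole ball of radius \<open>exp a\<close>.\<close>

lemma annular_bump_has_derivative:
  fixes x :: "'a::euclidean_space"
  assumes "a < b"
  shows "(annular_bump a b has_derivative (\<lambda>h. annular_slope a b x * (x \<bullet> h))) (at x)"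
proof (cases "x = 0")
  case True
  have "((\<lambda>x. 0) has_derivative (\<lambda>h. annular_slope a b x * (x \<bullet> h))) (at x)"
    using True by simp
  then show ?thesis
    by (rule has_derivative_transform_within_open[OF _ open_ball[of 0 "exp a"]])
       (use True in \<open>simp_all add: annular_zero(1)[OF assms]\<close>)
next
  case False
  have t: "((\<lambda>x. ln (norm x)) has_derivative (\<lambda>h. inverse (norm x) * (sgn x \<bullet> h))) (at x)"
    using has_derivative_compose[OF has_derivative_norm[OF False]
        DERIV_ln[of "norm x", unfolded has_field_derivative_def]] False
    by (simp add: inner_commute)
  let ?p = "\<lambda>t. (t - a) * (b - t)"
  have "((\<lambda>t. (max 0 (?p t))\<^sup>2) has_real_derivative 2 * max 0 (?p t) * (a + b - 2 * t)) (at t)" for t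
    by (rule DERIV_chain2[OF pos_part_square_has_derivative])
       (auto intro!: derivative_eq_intros simp: algebra_simps)
  from has_derivative_compose[OF t this[unfolded has_field_derivative_def]]
  have "((\<lambda>x. (max 0 (?p (ln (norm x))))\<^sup>2) has_derivative (\<lambda>h. annular_slope a b x * (x \<bullet> h))) (at x)"
    by (simp add: annular_slope_def sgn_div_norm field_simps power2_eq_square)
  then show ?thesis
    by (rule has_derivative_transform_within_open[OF _ open_Compl[OF closed_singleton[of 0]]])
       (use False in \<open>auto simp: annular_bump_def\<close>)
qed

lemma continuous_on_annular_slope:
  assumes "a < b"
  shows "continuous_on UNIV (annular_slope a b :: 'a::euclidean_space \<Rightarrow> real)"
proof -
  have "continuous_on (ball 0 (exp a)) (annular_slope a b :: 'a \<Rightarrow> real)"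
    by (rule continuous_on_eq[OF continuous_on_const[of _ 0]])
       (simp add: annular_zero(2)[OF assms])
  moreover have "continuous_on (- {0}) (annular_slope a b :: 'a \<Rightarrow> real)"
    unfolding annular_slope_def[abs_def] by (intro continuous_intros) auto
  ultimately have "continuous_on (ball 0 (exp a) \<union> - {0 :: 'a}) (annular_slope a b)"
    by (intro continuous_on_open_Un) auto
  moreover have "ball 0 (exp a) \<union> - {0 :: 'a} = UNIV" by auto
  ultimately show ?thesis by simp
qed

lemma annular_support: "x \<notin> cball 0 (exp b) \<Longrightarrow> a < b \<Longrightarrow> annular_bump a b x = 0"
  "x \<notin> cball 0 (exp b) \<Longrightarrow> a < b \<Longrightarrow> annular_slope a b x = 0"
  by (auto intro!: annular_zero)

text \<open>Up to a constant factor, the logarithmic length \<open>b - a\<close> bounds the integral of \<open>(norm x) powr - 2\<close>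
  over the annulus, because it does so over each annulus between two consecutive powers of \<open>e\<close>.\<close>

lemma annular_energy_bound:
  assumes "1 \<le> b - a"
  shows "(LINT x|lebesgue. (annular_slope a b (x :: real^2) * norm x)\<^sup>2) \<le> 3 * pi * (exp 1)\<^sup>2 * (b - a) ^ 7"
proof -
  have ab: "a < b" using assms by simp
  \<comment> \<open>Where \<open>norm x\<close> lies between \<open>exp k\<close> and
    \<open>exp (k + 1)\<close>, its power -2 is at most \<open>exp (- 2 * k)\<close>, while the
    enclosing disc has area \<open>pi * exp (2 * k + 2)\<close>. The product does not depend on
    \<open>k\<close>. The factor \<open>(b - a) ^ 6\<close> bounds the square of the derivative in
    the logarithmic variable.\<close>
  define G where "G k x = (b - a) ^ 6 * (exp (- 2 * real_of_int k) * indicator (ball 0 (exp (real_of_int k + 1))) x)"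
    for k :: int and x :: "real^2"
  have Gi: "integrable lebesgue (G k)" and Gv: "(LINT x|lebesgue. G k x) = (b - a) ^ 6 * (pi * (exp 1)\<^sup>2)" for k
  proof -
    have "(exp (real_of_int k + 1))\<^sup>2 * exp (- 2 * real_of_int k) = (exp 1)\<^sup>2"
      by (simp add: exp_double[symmetric] exp_add[symmetric])
    moreover have "integrable lebesgue (indicator (ball (0 :: real^2) r) :: _ \<Rightarrow> real)" for r
      using fmeasurableD2[OF lmeasurable_ball[of 0 r]] by (intro integrable_real_indicator) (auto simp: top.not_eq_extremum)
    ultimately show "integrable lebesgue (G k)" "(LINT x|lebesgue. G k x) = (b - a) ^ 6 * (pi * (exp 1)\<^sup>2)"
      unfolding G_def by (auto simp: circle_area mult_ac)
  qed
  have bound: "(annular_slope a b x * norm x)\<^sup>2 \<le> (\<Sum>k\<in>{\<lfloor>a\<rfloor>..\<lfloor>b\<rfloor>}. G k x)" for x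
  proof (cases "exp a < norm x \<and> norm x < exp b")
    case False
    then have "annular_slope a b x = 0" by (rule annular_zero(2)[OF ab])
    then show ?thesis using assms by (auto simp: G_def intro!: sum_nonneg)
  next
    case True
    then have x: "x \<noteq> 0" using less_trans[OF exp_gt_zero] by force
    define t where "t = ln (norm x)"
    have nx: "norm x = exp t" using x by (simp add: t_def)
    have t: "a < t" "t < b" using True by (auto simp: nx)
    have m: "(t - a) * (b - t) \<le> (b - a)\<^sup>2 / 4"
    proof -
      have "0 \<le> ((t - a) - (b - t))\<^sup>2" by simp
      then show ?thesis by (simp add: power2_eq_square field_simps)
    qed
    have s: "annular_slope a b x * norm x = 2 * ((t - a) * (b - t)) * (a + b - 2 * t) * exp (- t)"
    proof -
      have "max 0 ((t - a) * (b - t)) = (t - a) * (b - t)" using t by simp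
      then show ?thesis
        by (simp add: annular_slope_def nx exp_minus divide_inverse power2_eq_square)
    qed
    have "\<bar>2 * ((t - a) * (b - t)) * (a + b - 2 * t)\<bar> = 2 * ((t - a) * (b - t)) * \<bar>a + b - 2 * t\<bar>"
      using t by (simp add: abs_mult)
    also have "\<dots> \<le> (2 * ((b - a)\<^sup>2 / 4)) * (b - a)"
      using t m by (intro mult_mono) auto
    also have "\<dots> \<le> (b - a) ^ 3"
      using assms by (simp add: power2_eq_square power3_eq_cube)
    finally have "\<bar>annular_slope a b x * norm x\<bar> \<le> (b - a) ^ 3 * exp (- t)"
      unfolding s by (simp add: abs_mult)
    then have "(annular_slope a b x * norm x)\<^sup>2 \<le> ((b - a) ^ 3 * exp (- t))\<^sup>2"
      using power_mono[of "\<bar>annular_slope a b x * norm x\<bar>" _ 2] by simp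
    also have "\<dots> = (b - a) ^ 6 * exp (- 2 * t)"
      by (simp add: power_mult_distrib exp_double[symmetric] power_mult[symmetric])
    also have "\<dots> \<le> G \<lfloor>t\<rfloor> x"
    proof -
      have "x \<in> ball 0 (exp (real_of_int \<lfloor>t\<rfloor> + 1))" using nx by (simp add: dist_norm)
      moreover have "exp (- 2 * t) \<le> exp (- 2 * real_of_int \<lfloor>t\<rfloor>)" by simp
      ultimately show ?thesis using assms unfolding G_def by (intro mult_left_mono) auto
    qed
    also have "\<dots> \<le> (\<Sum>k\<in>{\<lfloor>a\<rfloor>..\<lfloor>b\<rfloor>}. G k x)"
      using t assms by (intro member_le_sum) (auto simp: G_def floor_mono)
    finally show ?thesis .
  qed
  have "continuous_on UNIV (\<lambda>x::real^2. (annular_slope a b x * norm x)\<^sup>2)"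
    by (intro continuous_intros continuous_on_annular_slope ab)
  then have "integrable lebesgue (\<lambda>x::real^2. (annular_slope a b x * norm x)\<^sup>2)"
    by (rule integrable_continuous_compact_support(2)[OF _ compact_cball[of 0 "exp b"]])
       (use ab annular_support(2) in auto)
  then have "(LINT x|lebesgue. (annular_slope a b (x :: real^2) * norm x)\<^sup>2)
      \<le> (LINT x|lebesgue. (\<Sum>k\<in>{\<lfloor>a\<rfloor>..\<lfloor>b\<rfloor>}. G k x))"
    by (rule integral_mono) (auto intro!: Bochner_Integration.integrable_sum Gi bound)
  also have "\<dots> = real (card {\<lfloor>a\<rfloor>..\<lfloor>b\<rfloor>}) * ((b - a) ^ 6 * (pi * (exp 1)\<^sup>2))"
    using Gi by (simp add: Bochner_Integration.integral_sum Gv)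
  \<comment> \<open>At most \<open>b - a + 2\<close> integers occur, and the 2 is absorbed because
    \<open>b - a\<close> is at least 1.\<close>
  also have "\<dots> \<le> (3 * (b - a)) * ((b - a) ^ 6 * (pi * (exp 1)\<^sup>2))"
  proof (rule mult_right_mono)
    have "\<lfloor>a\<rfloor> \<le> \<lfloor>b\<rfloor>" using ab by (intro floor_mono) simp
    then have "real (card {\<lfloor>a\<rfloor>..\<lfloor>b\<rfloor>}) = real_of_int \<lfloor>b\<rfloor> - real_of_int \<lfloor>a\<rfloor> + 1" by simp
    also have "\<dots> \<le> 3 * (b - a)"
      using assms of_int_floor_le[of b] real_of_int_floor_add_one_gt[of a] by argo
    finally show "real (card {\<lfloor>a\<rfloor>..\<lfloor>b\<rfloor>}) \<le> 3 * (b - a)" .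
  qed (use assms in simp)
  also have "\<dots> = 3 * pi * (exp 1)\<^sup>2 * (b - a) ^ 7" by (simp add: eval_nat_numeral)
  finally show ?thesis .
qed

text \<open>Each factor of the quadratic is at least \<open>(b - a) / 7\<close>, and the squared
  bump is the fourth power of their product. The margin 1/7 is the one supplied by
  \<open>annulus_log_bounds\<close>.\<close>

lemma annular_bump_lower_bound:
  fixes x :: "'a::euclidean_space"
  assumes "a < b" "x \<noteq> 0" "a + (b - a) / 7 \<le> ln (norm x)" "ln (norm x) \<le> b - (b - a) / 7"
  shows "(b - a) ^ 8 / 7 ^ 8 \<le> (annular_bump a b x)\<^sup>2"
proof -
  have "0 \<le> (b - a) / 7" using assms(1) by simp
  then have "((b - a) / 7) * ((b - a) / 7) \<le> (ln (norm x) - a) * (b - ln (norm x))"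
    using assms(3,4) by (intro mult_mono) linarith+
  then have "((b - a) / 7)\<^sup>2 \<le> max 0 ((ln (norm x) - a) * (b - ln (norm x)))"
    by (simp add: power2_eq_square)
  then have "(((b - a) / 7)\<^sup>2) ^ 4 \<le> (max 0 ((ln (norm x) - a) * (b - ln (norm x)))) ^ 4"
    by (rule power_mono) simp
  then show ?thesis
    using assms(2) by (simp add: annular_bump_def power_mult[symmetric] power_divide)
qed

subsection \<open>Negative subspaces from disjoint annuli\<close>

text \<open>A nonempty open set is not null, so it cannot lie in the exceptional set.\<close>

lemma AE_lebesgue_open_obtain:
  fixes U :: "'a::euclidean_space set"
  assumes "AE x in lebesgue. P x" "open U" "U \<noteq> {}"
  obtains x where "x \<in> U" "P x"
proof -
  have "\<not> (\<forall>x\<in>U. \<not> P x)"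
  proof
    assume "\<forall>x\<in>U. \<not> P x"
    then have "AE x in lebesgue. x \<in> - U"
      using assms(1) by (auto elim: eventually_mono)
    then have "AE x in lebesgue. x \<in> U \<longrightarrow> x \<in> {}"
      by (auto elim: eventually_mono)
    then have "x \<in> {}" if "x \<in> U" for x
      using mem_closed_if_AE_lebesgue_open[OF assms(2) closed_empty _ that] by simp
    then show False using assms(3) by blast
  qed
  then show ?thesis using that by blast
qed

lemma norm_sum_square_disjoint:
  fixes f :: "'i \<Rightarrow> 'a::real_normed_vector"
  assumes "finite S" "\<And>i j. i \<in> S \<Longrightarrow> j \<in> S \<Longrightarrow> i \<noteq> j \<Longrightarrow> f i = 0 \<or> f j = 0"
  shows "(norm (\<Sum>i\<in>S. f i))\<^sup>2 = (\<Sum>i\<in>S. (norm (f i))\<^sup>2)"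
proof (cases "\<exists>i\<in>S. f i \<noteq> 0")
  case True
  then obtain i where i: "i \<in> S" "f i \<noteq> 0" by blast
  then have z: "f j = 0" if "j \<in> S - {i}" for j using assms(2)[of i j] that by blast
  have "(\<Sum>j\<in>S. f j) = f i" "(\<Sum>j\<in>S. (norm (f j))\<^sup>2) = (norm (f i))\<^sup>2"
    using z by (simp_all add: sum.remove[OF assms(1) i(1)])
  then show ?thesis by simp
qed auto

text \<open>Isolates the linear algebra from the dyadic geometry. It is applied with the weight
  \<open>\<alpha> * V\<close> and with one residue class of indices as \<open>S\<close>. Touching
  intervals are allowed, since the annuli are open.\<close>

locale annular_family =
  fixes V :: "real^2 \<Rightarrow> real" and S :: "'i set" and a b :: "'i \<Rightarrow> real"
  assumes V: "locally_integrable V"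
    and S: "finite S"
    and ab: "\<And>i. i \<in> S \<Longrightarrow> a i < b i"
    and disjoint: "\<And>i j. i \<in> S \<Longrightarrow> j \<in> S \<Longrightarrow> i \<noteq> j \<Longrightarrow> b i \<le> a j \<or> b j \<le> a i"
    and negative: "\<And>i. i \<in> S \<Longrightarrow> (LINT x|lebesgue. (annular_slope (a i) (b i) (x :: real^2) * norm x)\<^sup>2)
        < (LINT x|lebesgue. V x * (annular_bump (a i) (b i) x)\<^sup>2)"
begin

definition comb :: "('i \<Rightarrow> complex) \<Rightarrow> real^2 \<Rightarrow> complex" where
  "comb c x = (\<Sum>i\<in>S. c i * complex_of_real (annular_bump (a i) (b i) x))"

definition comb' :: "('i \<Rightarrow> complex) \<Rightarrow> real^2 \<Rightarrow> real^2 \<Rightarrow> complex" where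
  "comb' c x h = (\<Sum>i\<in>S. c i * complex_of_real (annular_slope (a i) (b i) x * (x \<bullet> h)))"

definition support :: "(real^2) set" where
  "support = (\<Union>i\<in>S. cball 0 (exp (b i)))"

lemma disjoint_annuli:
  fixes x :: "real^2"
  assumes "i \<in> S" "j \<in> S" "i \<noteq> j"
  shows "\<not> (exp (a i) < norm x \<and> norm x < exp (b i)) \<or> \<not> (exp (a j) < norm x \<and> norm x < exp (b j))"
proof -
  have "exp (b i) \<le> exp (a j) \<or> exp (b j) \<le> exp (a i)"
    using disjoint[OF assms] by simp
  then show ?thesis by linarith
qed

lemma bump_disjoint:
  assumes "i \<in> S" "j \<in> S" "i \<noteq> j"
  shows "annular_bump (a i) (b i) (x :: real^2) = 0 \<or> annular_bump (a j) (b j) x = 0"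
    and "annular_slope (a i) (b i) (x :: real^2) = 0 \<or> annular_slope (a j) (b j) x = 0"
  using disjoint_annuli[OF assms, of x] annular_zero[OF ab[OF assms(1)], of x] annular_zero[OF ab[OF assms(2)], of x]
  by blast+

lemma compact_support: "compact support"
  unfolding support_def using S by (intro compact_UN) auto

lemma comb_outside: assumes "x \<notin> support" shows "comb c x = 0" "comb' c x h = 0"
proof -
  have "annular_bump (a i) (b i) x = 0" "annular_slope (a i) (b i) x = 0" if "i \<in> S" for i
    using assms that by (auto simp: support_def intro!: annular_support ab)
  then show "comb c x = 0" "comb' c x h = 0" by (simp_all add: comb_def comb'_def)
qed

lemma comb_has_derivative: "(comb c has_derivative comb' c x) (at x)"
proof -
  have "((\<lambda>x. c i * complex_of_real (annular_bump (a i) (b i) x)) has_derivative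
      (\<lambda>h. c i * complex_of_real (annular_slope (a i) (b i) x * (x \<bullet> h)))) (at x)" if "i \<in> S" for i
    by (intro has_derivative_mult_right has_derivative_of_real annular_bump_has_derivative ab[OF that])
  then show ?thesis
    unfolding comb_def[abs_def] comb'_def[abs_def] by (rule has_derivative_sum)
qed

lemma continuous_on_comb': "continuous_on UNIV (\<lambda>x. comb' c x h)"
  unfolding comb'_def by (intro continuous_intros continuous_on_annular_slope ab)

lemma continuous_on_comb: "continuous_on UNIV (comb c)"
  by (intro continuous_at_imp_continuous_on ballI has_derivative_continuous[OF comb_has_derivative])

lemma comb_in_dom: "comb c \<in> dom_E V"
proof -
  have "comb c \<in> W12"
    by (rule C1_compact_support_in_W12[OF comb_has_derivative continuous_on_comb' compact_support])
       (auto simp: comb_outside)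
  moreover have "comb c \<in> L2 V"
    by (rule continuous_compact_support_in_L2[OF continuous_on_comb compact_support _ V])
       (auto simp: comb_outside)
  ultimately show ?thesis by (simp add: dom_E_def)
qed

text \<open>At each point at most one bump and at most one slope is nonzero, so cross terms vanish
  pointwise and the form is diagonal in the coefficients.\<close>

lemma form_comb:
  "form_E V (comb c) = (\<Sum>i\<in>S. (norm (c i))\<^sup>2 *
     ((LINT x|lebesgue. (annular_slope (a i) (b i) (x :: real^2) * norm x)\<^sup>2) - (LINT x|lebesgue. V x * (annular_bump (a i) (b i) x)\<^sup>2)))"
proof -
  have grad: "(\<Sum>h\<in>Basis. (norm (comb' c x h))\<^sup>2) = (\<Sum>i\<in>S. (norm (c i))\<^sup>2 * (annular_slope (a i) (b i) x * norm x)\<^sup>2)" for x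
  proof -
    have "(norm (comb' c x h))\<^sup>2 = (\<Sum>i\<in>S. (norm (c i))\<^sup>2 * (annular_slope (a i) (b i) x)\<^sup>2 * (x \<bullet> h)\<^sup>2)" for h
      unfolding comb'_def
      by (subst norm_sum_square_disjoint[OF S])
         (use bump_disjoint(2) in \<open>auto simp: norm_mult power_mult_distrib mult_ac\<close>)
    then have "(\<Sum>h\<in>Basis. (norm (comb' c x h))\<^sup>2) =
        (\<Sum>i\<in>S. (norm (c i))\<^sup>2 * (annular_slope (a i) (b i) x)\<^sup>2 * (\<Sum>h\<in>Basis. (x \<bullet> h)\<^sup>2))"
      by (simp add: sum_distrib_left sum.swap[of _ _ Basis])
    also have "(\<Sum>h\<in>Basis. (x \<bullet> h)\<^sup>2) = (norm x)\<^sup>2"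
      unfolding power2_norm_eq_inner by (subst euclidean_inner) (simp add: power2_eq_square)
    finally show ?thesis by (simp add: power_mult_distrib mult_ac)
  qed
  have pot: "V x * (norm (comb c x))\<^sup>2 = (\<Sum>i\<in>S. (norm (c i))\<^sup>2 * (V x * (annular_bump (a i) (b i) x)\<^sup>2))" for x
    unfolding comb_def
    by (subst norm_sum_square_disjoint[OF S])
       (use bump_disjoint(1) in \<open>auto simp: norm_mult power_mult_distrib sum_distrib_left mult_ac\<close>)
  have i1: "integrable lebesgue (\<lambda>x::real^2. (annular_slope (a i) (b i) x * norm x)\<^sup>2)" if "i \<in> S" for i
    by (rule integrable_continuous_compact_support(2)[OF _ compact_cball[of 0 "exp (b i)"]])
       (use ab[OF that] annular_support(2) in \<open>auto intro!: continuous_intros continuous_on_annular_slope\<close>)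
  have i2: "integrable lebesgue (\<lambda>x. V x * (annular_bump (a i) (b i) x)\<^sup>2)" if "i \<in> S" for i
  proof -
    have "continuous_on UNIV (annular_bump (a i) (b i) :: real^2 \<Rightarrow> real)"
      by (intro continuous_at_imp_continuous_on ballI has_derivative_continuous[OF annular_bump_has_derivative[OF ab[OF that]]])
    then have "(\<lambda>x. complex_of_real (annular_bump (a i) (b i) x)) \<in> L2 V"
      by (intro continuous_compact_support_in_L2[OF _ compact_cball[of 0 "exp (b i)"] _ V])
         (use ab[OF that] annular_support(1) in \<open>auto intro!: continuous_intros\<close>)
    then show ?thesis by (simp add: L2_def)
  qed
  have "(LINT x|lebesgue. weak_grad_norm_sq (comb c) x) =
      (LINT x|lebesgue. (\<Sum>i\<in>S. (norm (c i))\<^sup>2 * (annular_slope (a i) (b i) (x :: real^2) * norm x)\<^sup>2))"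
    unfolding grad[symmetric]
    by (rule integral_weak_grad_norm_sq[where g="\<lambda>h x. comb' c x h"]) (intro is_weak_pderiv_C1 comb_has_derivative continuous_on_comb')
  also have "\<dots> = (\<Sum>i\<in>S. (norm (c i))\<^sup>2 * (LINT x|lebesgue. (annular_slope (a i) (b i) (x :: real^2) * norm x)\<^sup>2))"
    using i1 by (simp add: Bochner_Integration.integral_sum)
  finally show ?thesis
    using i2 by (simp add: form_E_def pot Bochner_Integration.integral_sum sum_subtractf right_diff_distrib)
qed

text \<open>Turns an almost everywhere statement into one at a point where exactly the bump of index
  \<open>i\<close> is nonzero. Evaluation there isolates a single coefficient.\<close>

lemma bump_pos_point:
  assumes "AE x in lebesgue. P (x :: real^2)" "i \<in> S"
  obtains x where "P x" "annular_bump (a i) (b i) x > 0" "\<And>j. j \<in> S \<Longrightarrow> j \<noteq> i \<Longrightarrow> annular_bump (a j) (b j) x = 0"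
proof -
  let ?U = "{x :: real^2. exp (a i) < norm x \<and> norm x < exp (b i)}"
  have "open ?U" by (intro open_Collect_conj open_Collect_less continuous_intros)
  moreover obtain t where "a i < t" "t < b i" using dense ab[OF assms(2)] by blast
  \<comment> \<open>A unit vector scaled by \<open>exp t\<close> has logarithmic coordinate
    \<open>t\<close>.\<close>
  then have "exp t *\<^sub>R axis 1 1 \<in> ?U" by simp
  then have "?U \<noteq> {}" by blast
  ultimately obtain x where x: "x \<in> ?U" "P x"
    using AE_lebesgue_open_obtain[OF assms(1)] by metis
  then have "annular_bump (a i) (b i) x > 0" using annular_bump_pos[OF ab[OF assms(2)]] by blast
  then show ?thesis using that x(2) bump_disjoint(1)[OF _ assms(2), of _ x] by force
qed

lemma form_comb_negative:
  assumes "\<not> (AE x in lebesgue. comb c x = 0)"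
  shows "form_E V (comb c) < 0"
proof -
  have "\<exists>i\<in>S. c i \<noteq> 0"
  proof (rule ccontr)
    assume "\<not> ?thesis"
    then have "comb c x = 0" for x by (simp add: comb_def)
    then show False using assms by simp
  qed
  then obtain i where i: "i \<in> S" "c i \<noteq> 0" by blast
  have "form_E V (comb c) < (\<Sum>i\<in>S. 0)"
    unfolding form_comb using S i negative
    by (intro sum_strict_mono_ex1)
       (auto simp: mult_less_0_iff mult_le_0_iff intro!: bexI[of _ i] less_imp_le)
  then show ?thesis by simp
qed

definition bumps :: "(real^2 \<Rightarrow> complex) set" where
  "bumps = (\<lambda>i x. complex_of_real (annular_bump (a i) (b i) x)) ` S"

text \<open>Both \<open>ae_independent\<close> and \<open>ae_dim\<close> deal with sets of
  functions, so distinct indices must give distinct bumps for the cardinality to carry over.\<close>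

lemma inj_bumps: "inj_on (\<lambda>i (x::real^2). complex_of_real (annular_bump (a i) (b i) x)) S"
proof (rule inj_onI)
  fix i j assume ij: "i \<in> S" "j \<in> S"
    and eq: "(\<lambda>x::real^2. complex_of_real (annular_bump (a i) (b i) x)) = (\<lambda>x. complex_of_real (annular_bump (a j) (b j) x))"
  obtain x where x: "annular_bump (a i) (b i) (x::real^2) > 0" "\<And>j. j \<in> S \<Longrightarrow> j \<noteq> i \<Longrightarrow> annular_bump (a j) (b j) x = 0"
    using bump_pos_point[of "\<lambda>_. True", OF _ ij(1)] by auto
  show "i = j"
    using x(1) x(2)[OF ij(2)] fun_cong[OF eq, of x] by force
qed

lemma ae_independent_bumps: "ae_independent bumps"
  unfolding ae_independent_def
proof (intro allI impI ballI)
  fix c u assume ae: "AE x in lebesgue. (\<Sum>u\<in>bumps. c u * u x) = 0" and "u \<in> bumps"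
  then obtain i where i: "i \<in> S" "u = (\<lambda>x. complex_of_real (annular_bump (a i) (b i) x))"
    by (auto simp: bumps_def)
  obtain x where x: "(\<Sum>u\<in>bumps. c u * u x) = 0" "annular_bump (a i) (b i) x > 0"
    "\<And>j. j \<in> S \<Longrightarrow> j \<noteq> i \<Longrightarrow> annular_bump (a j) (b j) x = 0"
    using bump_pos_point[OF ae i(1)] by blast
  have "(\<Sum>u\<in>bumps. c u * u x) =
      (\<Sum>j\<in>S. c (\<lambda>x. complex_of_real (annular_bump (a j) (b j) x)) * complex_of_real (annular_bump (a j) (b j) x))"
    unfolding bumps_def by (subst sum.reindex[OF inj_bumps]) simp
  also have "\<dots> = c u * complex_of_real (annular_bump (a i) (b i) x)"
    by (subst sum.remove[OF S i(1)]) (use x(3) i(2) in \<open>auto intro!: sum.neutral\<close>)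
  finally show "c u = 0" using x(1,2) by simp
qed

lemma card_le_N_minus: "enat (card S) \<le> N_minus (dom_E V) (form_E V)"
proof -
  have sub: "cfun.subspace (range comb)"
  proof (rule cfun.subspaceI)
    have "comb (\<lambda>_. 0) = 0" by (auto simp: comb_def fun_eq_iff)
    then show "0 \<in> range comb" by (metis rangeI)
    fix u v assume "u \<in> range comb" "v \<in> range comb"
    then obtain c d where "u = comb c" "v = comb d" by blast
    then have "u + v = comb (\<lambda>i. c i + d i)"
      by (auto simp: comb_def fun_eq_iff distrib_right sum.distrib)
    then show "u + v \<in> range comb" by blast
  next
    fix k u assume "u \<in> range comb"
    then obtain c where "u = comb c" by blast
    then have "(\<lambda>x. k * u x) = comb (\<lambda>i. k * c i)"
      by (auto simp: comb_def fun_eq_iff sum_distrib_left mult.assoc)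
    then show "(\<lambda>x. k * u x) \<in> range comb" by blast
  qed
  have "bumps \<subseteq> range comb"
  proof
    fix u assume "u \<in> bumps"
    then obtain i where i: "i \<in> S" "u = (\<lambda>x. complex_of_real (annular_bump (a i) (b i) x))"
      by (auto simp: bumps_def)
    have "comb (\<lambda>j. if j = i then 1 else 0) = u"
      by (auto simp: comb_def i fun_eq_iff sum.remove[OF S i(1)] intro!: sum.neutral)
    then show "u \<in> range comb" by blast
  qed
  moreover have "finite bumps" "card bumps = card S"
    using S inj_bumps by (auto simp: bumps_def card_image)
  ultimately have "enat (card S) \<le> ae_dim (range comb)"
    unfolding ae_dim_def using ae_independent_bumps by (intro SUP_upper2[of bumps]) auto
  also have "\<dots> \<le> N_minus (dom_E V) (form_E V)"
    unfolding N_minus_def using sub comb_in_dom form_comb_negative by (intro SUP_upper) auto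
  finally show ?thesis .
qed

end

subsection \<open>Dyadic annuli in the logarithmic scale\<close>

text \<open>The logarithmic coordinate \<open>ln (norm x)\<close> of \<open>annulus n\<close> lies well inside \<open>[log_lo n, log_hi n]\<close>,
  and these intervals do not overlap for indices in the same residue class modulo 3.\<close>

definition log_lo :: "int \<Rightarrow> real" where
  "log_lo n = (if n > 0 then 2 powi (n - 2) else if n = 0 then - 2 else - (2 powi (\<bar>n\<bar> + 1)))"

definition log_hi :: "int \<Rightarrow> real" where
  "log_hi n = (if n > 0 then 2 powi (n + 1) else if n = 0 then 2 else - (2 powi (\<bar>n\<bar> - 2)))"

lemma two_powi_shift:
  "(2::real) powi (k + 1) = 2 * 2 powi k" "(2::real) powi (k - 1) = 2 powi k / 2"
  "(2::real) powi (k - 2) = 2 powi k / 4"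
  by (simp_all add: power_int_add power_int_diff)

lemma two_powi_ge_2: "k \<ge> 1 \<Longrightarrow> (2::real) powi k \<ge> 2"
  using power_int_increasing[of 1 k "2::real"] by simp

text \<open>The length is 4 for \<open>n = 0\<close> and 7/4 times
  \<open>2 powi \<bar>n\<bar>\<close> otherwise. The bound 1 is what
  \<open>annular_energy_bound\<close> asks for.\<close>

lemma log_hi_minus_lo_ge_1: "1 \<le> log_hi n - log_lo n"
proof (cases "n = 0")
  case False
  then show ?thesis
    using two_powi_ge_2[of "\<bar>n\<bar>"] unfolding log_lo_def log_hi_def two_powi_shift by auto
qed (simp add: log_lo_def log_hi_def)

lemma log_lo_less_hi: "log_lo n < log_hi n"
  using log_hi_minus_lo_ge_1[of n] by linarith

text \<open>For positive indices the ends are \<open>2 powi (n + 1)\<close> and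
  \<open>2 powi (m - 2)\<close>, which are in order once \<open>m\<close> is at least
  \<open>n + 3\<close>. The ends -2 and 2 for index 0 meet those for -3 and 3 exactly.\<close>

lemma log_hi_le_lo:
  assumes "n < m" "n mod 3 = m mod 3"
  shows "log_hi n \<le> log_lo m"
proof -
  have m: "n + 3 \<le> m" using assms by presburger
  have pos: "(2::real) powi k > 0" for k by simp
  consider "n > 0" | "n = 0" | "n < 0" "m > 0" | "n < 0" "m = 0" | "n < 0" "m < 0" by linarith
  then show ?thesis
  proof cases
    case 1
    then show ?thesis
      using power_int_increasing[of "n + 1" "m - 2" "2::real"] m by (simp add: log_lo_def log_hi_def)
  next
    case 2
    then show ?thesis
      using two_powi_ge_2[of "m - 2"] m by (simp add: log_lo_def log_hi_def)
  next
    case 3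
    have "- (2 powi (\<bar>n\<bar> - 2)) \<le> (2::real) powi (m - 2)"
      using pos[of "\<bar>n\<bar> - 2"] pos[of "m - 2"] by linarith
    then show ?thesis using 3 by (simp add: log_lo_def log_hi_def)
  next
    case 4
    then show ?thesis
      using two_powi_ge_2[of "\<bar>n\<bar> - 2"] m by (simp add: log_lo_def log_hi_def)
  next
    case 5
    then show ?thesis
      using power_int_increasing[of "\<bar>m\<bar> + 1" "\<bar>n\<bar> - 2" "2::real"] m by (simp add: log_lo_def log_hi_def)
  qed
qed

text \<open>For \<open>n > 0\<close> and \<open>T = 2 powi n\<close> the annulus occupies
  \<open>T / 2\<close> to \<open>T\<close> inside an interval from \<open>T / 4\<close> to
  \<open>2 * T\<close>. The length is \<open>7 * T / 4\<close>, so the lower margin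
  \<open>T / 4\<close> is exactly one seventh of it. Negative indices are the mirror image.\<close>

lemma annulus_log_bounds:
  assumes "x \<in> annulus n"
  shows "x \<noteq> 0" "log_lo n + (log_hi n - log_lo n) / 7 \<le> ln (norm x)"
    "ln (norm x) \<le> log_hi n - (log_hi n - log_lo n) / 7"
    "n \<noteq> 0 \<Longrightarrow> \<bar>ln (norm x)\<bar> \<le> log_hi n - log_lo n"
proof -
  obtain u v where uv: "exp u < norm x" "norm x < exp v"
    "(n > 0 \<and> u = 2 powi n / 2 \<and> v = 2 powi n) \<or> (n = 0 \<and> u = - 1 \<and> v = 1) \<or>
     (n < 0 \<and> u = - (2 powi \<bar>n\<bar>) \<and> v = - (2 powi \<bar>n\<bar> / 2))"
    using assms unfolding annulus_def two_powi_shift by (auto split: if_splits)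
  have "norm x > 0" using uv(1) exp_gt_zero less_trans by blast
  then have t: "u < ln (norm x)" "ln (norm x) < v" "x \<noteq> 0"
    using uv(1,2) by (auto simp: ln_less_cancel_iff[symmetric, of _ "norm x"] ln_less_cancel_iff[symmetric, of "norm x"] simp del: ln_less_cancel_iff)
  define T where "T = (2::real) powi \<bar>n\<bar>"
  have T: "T > 0" by (simp add: T_def)
  have cases: "(n > 0 \<and> u = T / 2 \<and> v = T \<and> log_lo n = T / 4 \<and> log_hi n = 2 * T) \<or>
     (n = 0 \<and> u = - 1 \<and> v = 1 \<and> log_lo n = - 2 \<and> log_hi n = 2) \<or>
     (n < 0 \<and> u = - T \<and> v = - (T / 2) \<and> log_lo n = - 2 * T \<and> log_hi n = - (T / 4))"
    using uv(3) unfolding T_def log_lo_def log_hi_def two_powi_shift by auto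
  show "x \<noteq> 0" by fact
  show "log_lo n + (log_hi n - log_lo n) / 7 \<le> ln (norm x)"
    "ln (norm x) \<le> log_hi n - (log_hi n - log_lo n) / 7"
    "n \<noteq> 0 \<Longrightarrow> \<bar>ln (norm x)\<bar> \<le> log_hi n - log_lo n"
    using cases t(1,2) T by (auto simp: abs_le_iff)
qed

section \<open>Integrals of the potential over the annuli\<close>

lemma annulus_measurable: "annulus n \<in> sets lebesgue"
  unfolding annulus_def
  by (auto intro!: lmeasurable_open borel_open sets_completionI_sets open_Collect_conj open_Collect_less continuous_intros)

lemma annulus_subset_cball: "annulus n \<subseteq> cball 0 (exp (log_hi n))"
proof
  fix x assume x: "x \<in> annulus n"
  have "ln (norm x) \<le> log_hi n"
    using annulus_log_bounds(3)[OF x] log_lo_less_hi[of n] by (simp add: field_simps)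
  then have "exp (ln (norm x)) \<le> exp (log_hi n)" by simp
  then show "x \<in> cball 0 (exp (log_hi n))"
    using annulus_log_bounds(1)[OF x] by simp
qed

lemma set_integrable_annulus:
  assumes "locally_integrable V" shows "set_integrable lebesgue (annulus n) V"
proof (rule set_integrable_subset)
  show "set_integrable lebesgue (cball 0 (exp (log_hi n))) V"
    using assms by (simp add: locally_integrable_def)
qed (auto simp: annulus_measurable annulus_subset_cball)

lemma A_seq_nonneg:
  assumes "AE x in lebesgue. V x \<ge> 0" shows "A_seq V n \<ge> 0"
  unfolding A_seq_def set_lebesgue_integral_def
  using assms by (auto intro!: integral_nonneg_AE elim!: eventually_mono)

text \<open>On the annulus the logarithmic weight is at most the interval length, and for
  \<open>n = 0\<close> the weight 1 is too. This supplies the factor that lifts \<open>l ^ 7\<close>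
  to \<open>l ^ 8\<close> in the comparison of energy and potential.\<close>

lemma A_seq_le:
  assumes "AE x in lebesgue. V x \<ge> 0" "locally_integrable V"
  shows "A_seq V n \<le> (log_hi n - log_lo n) * (LINT x:annulus n|lebesgue. V x)"
proof -
  let ?l = "log_hi n - log_lo n"
  have int: "set_integrable lebesgue (annulus n) V" by (rule set_integrable_annulus[OF assms(2)])
  show ?thesis
  proof (cases "n = 0")
    case True
    have "0 \<le> (LINT x:annulus n|lebesgue. V x)"
      using A_seq_nonneg[OF assms(1), of 0] True by (simp add: A_seq_def)
    then show ?thesis using True log_hi_minus_lo_ge_1[of n]
      mult_right_mono[of 1 ?l "LINT x:annulus n|lebesgue. V x"] by (simp add: A_seq_def)
  next
    case False
    have "(LINT x:annulus n|lebesgue. V x * \<bar>ln (norm x)\<bar>) \<le> (LINT x:annulus n|lebesgue. ?l * V x)"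
      unfolding set_lebesgue_integral_def
    \<comment> \<open>The rule asks for a nonnegative integrable majorant; nonnegativity covers the
      default value 0 of the integral on the left.\<close>
    proof (rule integral_mono_AE')
      show "integrable lebesgue (\<lambda>x. indicator (annulus n) x *\<^sub>R (?l * V x))"
        using set_integrable_mult_right[of ?l, OF int] by (simp add: set_integrable_def)
      show "AE x in lebesgue. indicator (annulus n) x *\<^sub>R (V x * \<bar>ln (norm x)\<bar>) \<le> indicator (annulus n) x *\<^sub>R (?l * V x)"
        using assms(1) 
      proof eventually_elim
        case (elim x)
        then show ?case
          using annulus_log_bounds(4)[OF _ False, of x] mult_right_mono[of "\<bar>ln (norm x)\<bar>" ?l "V x"]
          by (cases "x \<in> annulus n") (auto simp: mult.commute)
      qed
      show "AE x in lebesgue. 0 \<le> indicator (annulus n) x *\<^sub>R (?l * V x)"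
        using assms(1) log_hi_minus_lo_ge_1[of n] by (auto elim!: eventually_mono)
    qed
    then show ?thesis using False by (simp add: A_seq_def)
  qed
qed

lemma annulus_integral_le:
  assumes "AE x in lebesgue. V x \<ge> 0" "locally_integrable V"
  shows "(log_hi n - log_lo n) ^ 8 / 7 ^ 8 * (LINT x:annulus n|lebesgue. V x)
    \<le> (LINT x|lebesgue. V x * (annular_bump (log_lo n) (log_hi n) x)\<^sup>2)"
proof -
  let ?w = "annular_bump (log_lo n) (log_hi n) :: real^2 \<Rightarrow> real"
  let ?k = "(log_hi n - log_lo n) ^ 8 / 7 ^ 8"
  have "continuous_on UNIV ?w"
    by (intro continuous_at_imp_continuous_on ballI has_derivative_continuous[OF annular_bump_has_derivative[OF log_lo_less_hi]])
  \<comment> \<open>The real bump is viewed as complex because \<open>L2\<close> consists of complex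
    functions; only the integrability it yields is kept.\<close>
  then have "(\<lambda>x. complex_of_real (?w x)) \<in> L2 V"
    by (intro continuous_compact_support_in_L2[OF _ compact_cball[of 0 "exp (log_hi n)"] _ assms(2)])
       (use log_lo_less_hi annular_support(1) in \<open>auto intro!: continuous_intros\<close>)
  then have "integrable lebesgue (\<lambda>x. V x * (?w x)\<^sup>2)" by (simp add: L2_def)
  moreover have "AE x in lebesgue. indicator (annulus n) x *\<^sub>R (?k * V x) \<le> V x * (?w x)\<^sup>2"
    using assms(1)
  proof eventually_elim
    case (elim x)
    show ?case
    proof (cases "x \<in> annulus n")
      case True
      then have "?k \<le> (?w x)\<^sup>2"
        by (intro annular_bump_lower_bound log_lo_less_hi annulus_log_bounds)
      then show ?thesis using True elim mult_left_mono[of ?k "(?w x)\<^sup>2" "V x"] by (simp add: mult.commute)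
    qed (use elim in simp)
  qed
  moreover have "integrable lebesgue (\<lambda>x. indicator (annulus n) x *\<^sub>R (?k * V x))"
    using set_integrable_mult_right[of ?k, OF set_integrable_annulus[OF assms(2)]] by (simp add: set_integrable_def)
  ultimately have "(LINT x:annulus n|lebesgue. ?k * V x) \<le> (LINT x|lebesgue. V x * (?w x)\<^sup>2)"
    unfolding set_lebesgue_integral_def by (intro integral_mono_AE)
  then show ?thesis by simp
qed

text \<open>The constant of \<open>annular_energy_bound\<close> divided by the constant
  \<open>1 / 7 ^ 8\<close> of \<open>annular_bump_lower_bound\<close>.\<close>

definition threshold :: real where "threshold = 7 ^ 8 * (3 * pi * (exp 1)\<^sup>2)"

lemma threshold_pos: "threshold > 0"
  by (simp add: threshold_def)

lemma annular_form_negative: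
  assumes V: "AE x in lebesgue. V x \<ge> 0" "locally_integrable V" and "\<alpha> > 0" "\<alpha> * A_seq V n > threshold"
  shows "(LINT x|lebesgue. (annular_slope (log_lo n) (log_hi n) (x :: real^2) * norm x)\<^sup>2)
    < (LINT x|lebesgue. \<alpha> * V x * (annular_bump (log_lo n) (log_hi n) x)\<^sup>2)"
proof -
  define l where "l = log_hi n - log_lo n"
  define J where "J = (LINT x:annulus n|lebesgue. V x)"
  have l: "l \<ge> 1" using log_hi_minus_lo_ge_1 by (simp add: l_def)
  have "(LINT x|lebesgue. (annular_slope (log_lo n) (log_hi n) (x :: real^2) * norm x)\<^sup>2) \<le> threshold * (l ^ 7 / 7 ^ 8)"
    using annular_energy_bound[OF log_hi_minus_lo_ge_1[of n]] by (simp add: threshold_def l_def)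
  also have "\<dots> < (\<alpha> * A_seq V n) * (l ^ 7 / 7 ^ 8)"
    using assms(4) l by (intro mult_strict_right_mono) auto
  also have "\<dots> \<le> (\<alpha> * (l * J)) * (l ^ 7 / 7 ^ 8)"
    using A_seq_le[OF V, of n] assms(3) l by (intro mult_right_mono mult_left_mono) (auto simp: l_def J_def)
  also have "\<dots> = \<alpha> * (l ^ 8 / 7 ^ 8 * J)"
    by (simp add: eval_nat_numeral)
  also have "\<dots> \<le> \<alpha> * (LINT x|lebesgue. V x * (annular_bump (log_lo n) (log_hi n) x)\<^sup>2)"
    using annulus_integral_le[OF V, of n] assms(3) by (simp add: l_def J_def)
  finally show ?thesis by (simp add: mult.assoc)
qed

section \<open>Counting large values of the sequence\<close>

lemma card_le_N_minus_bound:
  assumes V: "AE x in lebesgue. V x \<ge> 0" "locally_integrable V" and "\<alpha> > 0"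
    and S: "finite S" "\<And>n. n \<in> S \<Longrightarrow> \<alpha> * A_seq V n > threshold"
    and B: "ereal_of_enat (N_minus (dom_E (\<lambda>x. \<alpha> * V x)) (form_E (\<lambda>x. \<alpha> * V x))) \<le> ereal B"
  shows "real (card S) \<le> 3 * B"
proof -
  have le: "real (card {n \<in> S. n mod 3 = r}) \<le> B" for r
  proof -
    interpret annular_family "\<lambda>x. \<alpha> * V x" "{n \<in> S. n mod 3 = r}" log_lo log_hi
    proof
      show "locally_integrable (\<lambda>x. \<alpha> * V x)"
        using V(2) by (auto simp: locally_integrable_def)
      show "log_hi i \<le> log_lo j \<or> log_hi j \<le> log_lo i"
        if "i \<in> {n \<in> S. n mod 3 = r}" "j \<in> {n \<in> S. n mod 3 = r}" "i \<noteq> j" for i j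
        using that log_hi_le_lo[of i j] log_hi_le_lo[of j i] by (cases "i < j") auto
    qed (use S annular_form_negative[OF V assms(3)] log_lo_less_hi in auto)
    have "ereal_of_enat (enat (card {n \<in> S. n mod 3 = r})) \<le> ereal B"
      using card_le_N_minus B by (meson ereal_of_enat_le_iff order_trans)
    then show ?thesis by simp
  qed
  have "n mod 3 = 0 \<or> n mod 3 = 1 \<or> n mod 3 = 2" for n :: int by presburger
  then have "S = (\<Union>r\<in>{0, 1, 2}. {n \<in> S. n mod 3 = r})" by blast
  also have "card \<dots> \<le> (\<Sum>r\<in>{0, 1, 2 :: int}. card {n \<in> S. n mod 3 = r})"
    by (rule card_UN_le) simp
  finally have "card S \<le> (\<Sum>r\<in>{0, 1, 2 :: int}. card {n \<in> S. n mod 3 = r})" .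
  then have "real (card S) \<le> (\<Sum>r\<in>{0, 1, 2 :: int}. real (card {n \<in> S. n mod 3 = r}))"
    unfolding of_nat_sum[symmetric] by (simp only: of_nat_le_iff)
  also have "\<dots> \<le> (\<Sum>r\<in>{0, 1, 2 :: int}. B)" by (intro sum_mono le)
  finally show ?thesis by simp
qed

text \<open>Small \<open>s\<close> suffice: for \<open>s > s0\<close> the level set lies in the finite one at \<open>s0\<close>, so it is empty for
  large \<open>s\<close>.\<close>

lemma weak_l1_norm_finiteI:
  assumes "s0 > 0"
    and bound: "\<And>s S. 0 < s \<Longrightarrow> s \<le> s0 \<Longrightarrow> finite S \<Longrightarrow> (\<And>n. n \<in> S \<Longrightarrow> \<bar>a n\<bar> > s) \<Longrightarrow> s * real (card S) \<le> M"
  shows "weak_l1_norm a < \<infinity>"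
proof -
  define F where "F s = {n. \<bar>a n\<bar> > s}" for s
  have fin: "finite (F s)" if "0 < s" "s \<le> s0" for s
  proof -
    \<comment> \<open>The counting measure is infinite on infinite sets, so finiteness of the level
      set has to be derived, from a uniform bound on its finite subsets.\<close>
    have "card G \<le> nat \<lfloor>M / s\<rfloor>" if "G \<subseteq> F s" "finite G" for G
    proof -
      have "s * real (card G) \<le> M"
        by (rule bound[OF \<open>0 < s\<close> \<open>s \<le> s0\<close> that(2)]) (use that(1) in \<open>auto simp: F_def\<close>)
      then show ?thesis using \<open>0 < s\<close> by (simp add: le_nat_floor field_simps)
    qed
    then show ?thesis using finite_if_finite_subsets_card_bdd by metis
  qed
  \<comment> \<open>The sum serves levels above \<open>s0\<close>: each term counted there exceeds
    \<open>s\<close>, so \<open>s\<close> times their number is at most this fixed finite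
    sum.\<close>
  define M' where "M' = max M (\<Sum>n\<in>F s0. \<bar>a n\<bar>)"
  have "ennreal s * emeasure (count_space UNIV) (F s) \<le> ennreal M'" if "s > 0" for s
  proof -
    have "finite (F s) \<and> s * real (card (F s)) \<le> M'"
    proof (cases "s \<le> s0")
      case True
      then have f: "finite (F s)" using fin[OF that] by blast
      have "s * real (card (F s)) \<le> M"
        by (rule bound[OF that True f]) (simp add: F_def)
      then show ?thesis using f by (simp add: M'_def)
    next
      case False
      then have sub: "F s \<subseteq> F s0" by (auto simp: F_def)
      then have f: "finite (F s)" using fin[OF assms(1)] finite_subset by blast
      have "s * real (card (F s)) = (\<Sum>n\<in>F s. s)" by simp
      also have "\<dots> \<le> (\<Sum>n\<in>F s. \<bar>a n\<bar>)" by (intro sum_mono) (auto simp: F_def)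
      also have "\<dots> \<le> (\<Sum>n\<in>F s0. \<bar>a n\<bar>)"
        using fin[OF assms(1)] sub by (intro sum_mono2) auto
      finally show ?thesis using f by (simp add: M'_def)
    qed
    then show ?thesis using that
      by (simp add: ennreal_of_nat_eq_real_of_nat ennreal_mult[symmetric] ennreal_leI)
  qed
  note le = this
  have "weak_l1_norm a \<le> ennreal M'"
    unfolding weak_l1_norm_def by (intro SUP_least) (use le in \<open>auto simp: F_def\<close>)
  also have "\<dots> < \<infinity>" by simp
  finally show ?thesis .
qed

theorem theorem9p2:
  fixes V :: "real^2 \<Rightarrow> real"
  assumes "AE x in lebesgue. V x \<ge> 0"
    and "locally_integrable V"
    and "\<exists>C::real. \<forall>\<^sub>F \<alpha> in at_top.
           ereal_of_enat (N_minus (dom_E (\<lambda>x. \<alpha> * V x)) (form_E (\<lambda>x. \<alpha> * V x)))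
             \<le> ereal (C * \<alpha>)"
  shows "weak_l1_norm (A_seq V) < \<infinity>"
proof -
  obtain C \<alpha>0 where \<alpha>0: "\<And>\<alpha>. \<alpha> \<ge> \<alpha>0 \<Longrightarrow>
      ereal_of_enat (N_minus (dom_E (\<lambda>x. \<alpha> * V x)) (form_E (\<lambda>x. \<alpha> * V x))) \<le> ereal (C * \<alpha>)"
    using assms(3) by (auto simp: eventually_at_top_linorder)
  define \<alpha>1 where "\<alpha>1 = max \<alpha>0 1"
  then have \<alpha>1: "\<alpha>1 > 0" by simp
  show ?thesis
  proof (rule weak_l1_norm_finiteI)
    show "threshold / \<alpha>1 > 0" using threshold_pos by (simp add: \<alpha>1_def)
    fix s and S :: "int set"
    assume s: "0 < s" "s \<le> threshold / \<alpha>1" and S: "finite S" "\<And>n. n \<in> S \<Longrightarrow> \<bar>A_seq V n\<bar> > s"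
    \<comment> \<open>With this coupling, values above \<open>s\<close> become values of
      \<open>\<alpha> * A_seq V n\<close> above \<open>threshold\<close>, and the upper bound on
      \<open>s\<close> says that \<alpha> is in the range of the growth hypothesis. The product
      \<open>s * \<alpha>\<close> is constant, so the bound is uniform in \<open>s\<close>.\<close>
    define \<alpha> where "\<alpha> = threshold / s"
    have \<alpha>: "\<alpha> > 0" "\<alpha> \<ge> \<alpha>1"
      using s threshold_pos \<alpha>1 by (simp_all add: \<alpha>_def field_simps)
    have "real (card S) \<le> 3 * (C * \<alpha>)"
    proof (rule card_le_N_minus_bound[OF assms(1,2) \<alpha>(1) S(1)])
      show "\<alpha> * A_seq V n > threshold" if "n \<in> S" for n
        using S(2)[OF that] A_seq_nonneg[OF assms(1), of n] s(1) threshold_pos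
        by (simp add: \<alpha>_def field_simps)
      show "ereal_of_enat (N_minus (dom_E (\<lambda>x. \<alpha> * V x)) (form_E (\<lambda>x. \<alpha> * V x))) \<le> ereal (C * \<alpha>)"
        by (rule \<alpha>0) (use \<alpha>(2) in \<open>simp add: \<alpha>1_def\<close>)
    qed
    then have "s * real (card S) \<le> s * (3 * (C * \<alpha>))" using s(1) by (intro mult_left_mono) auto
    also have "\<dots> = 3 * C * threshold" using s(1) by (simp add: \<alpha>_def)
    finally show "s * real (card S) \<le> 3 * C * threshold" .
  qed
qed

end
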